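(* Let $R$ be a right noetherian ring, let $F$ be an indecomposable injective right $R$-module and let $I$ be the maximal ideal of the local ring $\operatorname{End}_R(F)$. Then $\mathcal{A}_I$ is the unique maximal ideal of the category $\mathbf{C}_F$.
   Context: Rings are associative with unit, not necessarily commutative; modules are right modules. An injective module is indecomposable if and only if its endomorphism ring is local. For $R$ right noetherian and $F$ indecomposable injective, every module $M$ has a decomposition $M=M_1\oplus M_2$ with $M_1\cong F^{(\kappa)}$ (direct sum of $\kappa$ copies of $F$) for some cardinal $\kappa$ and $M_2$ having no direct summand isomorphic to $F$; the cardinal $\kappa$ is uniquely determined by $M$ and is called the $F$-rank $\mathrm{r}_F(M)$ of $M$. $\mathbf{C}_F$ denotes the full subcategory of $\text{Mod-}R$ whose objects are all modules of finite $F$-rank. An ideal $\mathcal{I}$ of a preadditive category $\mathbf{C}$ assigns to each pair of objects $A,B$ a subgroup $\mathcal{I}(A,B)$ of $\operatorname{Hom}_{\mathbf{C}}(A,B)$ such that $gif\in\mathcal{I}(X,Y)$ for all $f\colon X\to A$, $i\in\mathcal{I}(A,B)$, $g\colon B\to Y$. It is maximal if it is proper (not equal to $\operatorname{Hom}_{\mathbf{C}}$) and is not properly contained in any other proper ideal. $\mathcal{A}_I$ is the ideal of $\mathbf{C}_F$ associated to $I$: for $X,Y\in\mathbf{C}_F$, $\mathcal{A}_I(X,Y)=\{f\in\operatorname{Hom}_R(X,Y):\beta f\alpha\in I\text{ for all }\alpha\in\operatorname{Hom}_R(F,X)\text{ and }\beta\in\operatorname{Hom}_R(Y,F)\}$.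 *)

theory Defs
  imports "HOL-Algebra.Module" "HOL-Algebra.Ideal"
begin

unbundle cardinal_syntax

section \<open>Universe\<close>

text \<open>
  The modules of \<open>Mod-R\<close> live in a universe.  A type \<open>'u\<close> plays the role
  of the universe and a set is small if it has strictly fewer elements than \<open>'u\<close>; the small modules
  are those carried by a small subset of \<open>'u\<close>.  If \<open>'u\<close> is a Grothendieck universe containing
  the natural numbers as an element, the small subsets of \<open>'u\<close> are exactly its elements, and \<open>Mod-R\<close> is
  the usual category of modules belonging to it.  Of the closure properties of a universe only
  those under subsets, power sets and the existence of an infinite small set are required (so
  regularity of the cardinality of \<open>'u\<close> is not demanded).

  Admitting all modules carried by arbitrary subsets of a fixed type would not do: there is then a
  largest possible cardinality of a module, which destroys the closure of \<open>Mod-R\<close> under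
  small direct sums, and produces maximal ideals that do not exist in the genuine \<open>Mod-R\<close>
  (for instance, those maps of vector spaces whose rank is less than the largest dimension).
\<close>

definition small :: "'u itself \<Rightarrow> 'a set \<Rightarrow> bool" where
  "small (_ :: 'u itself) A \<longleftrightarrow> |A| <o |UNIV :: 'u set|"

definition universe :: "'u itself \<Rightarrow> bool" where
  "universe (U :: 'u itself) \<longleftrightarrow>
     small U (UNIV :: nat set) \<and> (\<forall>A :: 'u set. small U A \<longrightarrow> small U (Pow A))"


section \<open>Right modules\<close>

text \<open>
  The record of the library is reused, but \<open>a \<odot>\<^bsub>M\<^esub> x\<close> stands for the product
  \<open>x a\<close> of an element \<open>x\<close> of a right module by a scalar \<open>a\<close>; hence the order of the
  factors in \<open>smult_assoc\<close>.  As for modules in the library, the fields \<open>mult\<close> and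
  \<open>one\<close> of the record are irrelevant.
\<close>

locale right_module = R?: ring R + M?: abelian_group M for R (structure) and M (structure) +
  assumes smult_closed:
      "\<lbrakk>a \<in> carrier R; x \<in> carrier M\<rbrakk> \<Longrightarrow> a \<odot>\<^bsub>M\<^esub> x \<in> carrier M"
    and smult_l_distr:
      "\<lbrakk>a \<in> carrier R; b \<in> carrier R; x \<in> carrier M\<rbrakk> \<Longrightarrow>
        (a \<oplus> b) \<odot>\<^bsub>M\<^esub> x = a \<odot>\<^bsub>M\<^esub> x \<oplus>\<^bsub>M\<^esub> b \<odot>\<^bsub>M\<^esub> x"
    and smult_r_distr:
      "\<lbrakk>a \<in> carrier R; x \<in> carrier M; y \<in> carrier M\<rbrakk> \<Longrightarrow>
        a \<odot>\<^bsub>M\<^esub> (x \<oplus>\<^bsub>M\<^esub> y) = a \<odot>\<^bsub>M\<^esub> x \<oplus>\<^bsub>M\<^esub> a \<odot>\<^bsub>M\<^esub> y"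
    and smult_assoc:
      "\<lbrakk>a \<in> carrier R; b \<in> carrier R; x \<in> carrier M\<rbrakk> \<Longrightarrow>
        (a \<otimes> b) \<odot>\<^bsub>M\<^esub> x = b \<odot>\<^bsub>M\<^esub> (a \<odot>\<^bsub>M\<^esub> x)"
    and smult_one:
      "x \<in> carrier M \<Longrightarrow> \<one> \<odot>\<^bsub>M\<^esub> x = x"

text \<open>The objects of \<open>Mod-R\<close>.\<close>

definition small_modules :: "('r, 'x) ring_scheme \<Rightarrow> ('r, 'u) module set" where
  "small_modules R = {M. right_module R M \<and> small TYPE('u) (carrier M)}"

text \<open>Homomorphisms are extensional functions, so that equality of morphisms is equality in HOL.\<close>

definition Hom ::
  "('r, 'x) ring_scheme \<Rightarrow> ('r, 'a) module \<Rightarrow> ('r, 'b) module \<Rightarrow> ('a \<Rightarrow> 'b) set" where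
  "Hom R M N = {f \<in> carrier M \<rightarrow>\<^sub>E carrier N.
     (\<forall>x\<in>carrier M. \<forall>y\<in>carrier M. f (x \<oplus>\<^bsub>M\<^esub> y) = f x \<oplus>\<^bsub>N\<^esub> f y) \<and>
     (\<forall>a\<in>carrier R. \<forall>x\<in>carrier M. f (a \<odot>\<^bsub>M\<^esub> x) = a \<odot>\<^bsub>N\<^esub> f x)}"

text \<open>The additive group of homomorphisms, as a \<open>monoid\<close> record.\<close>

definition Hom_group ::
  "('r, 'x) ring_scheme \<Rightarrow> ('r, 'a) module \<Rightarrow> ('r, 'b) module \<Rightarrow> ('a \<Rightarrow> 'b) monoid" where
  "Hom_group R M N =
     \<lparr>carrier = Hom R M N,
      monoid.mult = (\<lambda>f g. \<lambda>x\<in>carrier M. f x \<oplus>\<^bsub>N\<^esub> g x),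
      one = (\<lambda>x\<in>carrier M. \<zero>\<^bsub>N\<^esub>)\<rparr>"

definition End :: "('r, 'x) ring_scheme \<Rightarrow> ('r, 'a) module \<Rightarrow> ('a \<Rightarrow> 'a) ring" where
  "End R M =
     \<lparr>carrier = Hom R M M,
      monoid.mult = (\<lambda>f g. compose (carrier M) f g),
      one = (\<lambda>x\<in>carrier M. x),
      zero = (\<lambda>x\<in>carrier M. \<zero>\<^bsub>M\<^esub>),
      add = (\<lambda>f g. \<lambda>x\<in>carrier M. f x \<oplus>\<^bsub>M\<^esub> g x)\<rparr>"

definition isomorphic ::
  "('r, 'x) ring_scheme \<Rightarrow> ('r, 'a) module \<Rightarrow> ('r, 'b) module \<Rightarrow> bool" where
  "isomorphic R M N \<longleftrightarrow> (\<exists>f\<in>Hom R M N. bij_betw f (carrier M) (carrier N))"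

text \<open>\<open>M\<close> is the internal direct sum of its submodules \<open>A\<close> and \<open>B\<close>.\<close>

definition internal_direct_sum ::
  "('r, 'x) ring_scheme \<Rightarrow> ('r, 'a) module \<Rightarrow> 'a set \<Rightarrow> 'a set \<Rightarrow> bool" where
  "internal_direct_sum R M A B \<longleftrightarrow>
     submodule A R M \<and> submodule B R M \<and> A \<inter> B = {\<zero>\<^bsub>M\<^esub>} \<and>
     (\<forall>x\<in>carrier M. \<exists>a\<in>A. \<exists>b\<in>B. x = a \<oplus>\<^bsub>M\<^esub> b)"

definition has_summand_isomorphic ::
  "('r, 'x) ring_scheme \<Rightarrow> ('r, 'a) module \<Rightarrow> ('r, 'b) module \<Rightarrow> bool" where
  "has_summand_isomorphic R M F \<longleftrightarrow>
     (\<exists>A B. internal_direct_sum R M A B \<and> isomorphic R (M\<lparr>carrier := A\<rparr>) F)"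

definition indecomposable :: "('r, 'x) ring_scheme \<Rightarrow> ('r, 'a) module \<Rightarrow> bool" where
  "indecomposable R M \<longleftrightarrow> carrier M \<noteq> {\<zero>\<^bsub>M\<^esub>} \<and>
     (\<forall>A B. internal_direct_sum R M A B \<longrightarrow> A = {\<zero>\<^bsub>M\<^esub>} \<or> B = {\<zero>\<^bsub>M\<^esub>})"

definition injective :: "('r, 'x) ring_scheme \<Rightarrow> ('r, 'u) module \<Rightarrow> bool" where
  "injective R E \<longleftrightarrow>
     (\<forall>(A :: ('r, 'u) module)\<in>small_modules R. \<forall>(B :: ('r, 'u) module)\<in>small_modules R.
        \<forall>i\<in>Hom R A B. inj_on i (carrier A) \<longrightarrow>
          (\<forall>g\<in>Hom R A E. \<exists>h\<in>Hom R B E. compose (carrier A) h i = g))"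

definition right_ideal :: "'r set \<Rightarrow> ('r, 'x) ring_scheme \<Rightarrow> bool" where
  "right_ideal A R \<longleftrightarrow>
     additive_subgroup A R \<and> (\<forall>a\<in>A. \<forall>r\<in>carrier R. a \<otimes>\<^bsub>R\<^esub> r \<in> A)"

definition right_noetherian :: "('r, 'x) ring_scheme \<Rightarrow> bool" where
  "right_noetherian R \<longleftrightarrow> ring R \<and>
     (\<forall>A :: nat \<Rightarrow> 'r set. (\<forall>n. right_ideal (A n) R \<and> A n \<subseteq> A (Suc n)) \<longrightarrow>
        (\<exists>m. \<forall>n\<ge>m. A n = A m))"


section \<open>Modules of finite \<open>F\<close>-rank\<close>

text \<open>The direct sum \<open>F\<^sup>(\<^sup>K\<^sup>)\<close> of copies of \<open>F\<close> indexed by a set \<open>K\<close>.\<close>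

definition copower :: "'k set \<Rightarrow> ('r, 'a) module \<Rightarrow> ('r, 'k \<Rightarrow> 'a) module" where
  "copower K F =
     \<lparr>carrier = {f \<in> K \<rightarrow>\<^sub>E carrier F. finite {k \<in> K. f k \<noteq> \<zero>\<^bsub>F\<^esub>}},
      monoid.mult = undefined,
      one = undefined,
      zero = (\<lambda>k\<in>K. \<zero>\<^bsub>F\<^esub>),
      add = (\<lambda>f g. \<lambda>k\<in>K. f k \<oplus>\<^bsub>F\<^esub> g k),
      smult = (\<lambda>a f. \<lambda>k\<in>K. a \<odot>\<^bsub>F\<^esub> f k)\<rparr>"

text \<open>
  The \<open>F\<close>-rank of \<open>M\<close> is the cardinality of \<open>K\<close>.  It is a relation here; that the
  cardinality exists and is unique (for \<open>R\<close> right noetherian and \<open>F\<close> indecomposable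
  injective) is a theorem.
\<close>

definition has_rank ::
  "('r, 'x) ring_scheme \<Rightarrow> ('r, 'a) module \<Rightarrow> ('r, 'b) module \<Rightarrow> 'k set \<Rightarrow> bool" where
  "has_rank R F M K \<longleftrightarrow>
     (\<exists>M1 M2. internal_direct_sum R M M1 M2 \<and>
        isomorphic R (M\<lparr>carrier := M1\<rparr>) (copower K F) \<and>
        \<not> has_summand_isomorphic R (M\<lparr>carrier := M2\<rparr>) F)"

text \<open>The objects of the full subcategory \<open>C\<^sub>F\<close> of \<open>Mod-R\<close>.\<close>

definition finite_rank_modules ::
  "('r, 'x) ring_scheme \<Rightarrow> ('r, 'u) module \<Rightarrow> ('r, 'u) module set" where
  "finite_rank_modules R F = {M \<in> small_modules R. \<exists>n :: nat. has_rank R F M {..<n}}"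


section \<open>Ideals of full subcategories of \<open>Mod-R\<close>\<close>

text \<open>
  A full subcategory is given by its set \<open>\<C>\<close> of objects.  The values of \<open>J X Y\<close> for
  \<open>X\<close> or \<open>Y\<close> not in \<open>\<C>\<close> are irrelevant, so ideals are compared by
  \<open>cat_ideal_le\<close> rather than as HOL functions.
\<close>

type_synonym ('r, 'u) hom_family = "('r, 'u) module \<Rightarrow> ('r, 'u) module \<Rightarrow> ('u \<Rightarrow> 'u) set"

definition cat_ideal ::
  "('r, 'x) ring_scheme \<Rightarrow> ('r, 'u) module set \<Rightarrow> ('r, 'u) hom_family \<Rightarrow> bool" where
  "cat_ideal R \<C> J \<longleftrightarrow>
     (\<forall>A\<in>\<C>. \<forall>B\<in>\<C>. subgroup (J A B) (Hom_group R A B)) \<and>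
     (\<forall>X\<in>\<C>. \<forall>A\<in>\<C>. \<forall>B\<in>\<C>. \<forall>Y\<in>\<C>.
        \<forall>f\<in>Hom R X A. \<forall>i\<in>J A B. \<forall>g\<in>Hom R B Y.
          compose (carrier X) g (compose (carrier X) i f) \<in> J X Y)"

definition cat_ideal_le ::
  "('r, 'u) module set \<Rightarrow> ('r, 'u) hom_family \<Rightarrow> ('r, 'u) hom_family \<Rightarrow> bool" where
  "cat_ideal_le \<C> J K \<longleftrightarrow> (\<forall>A\<in>\<C>. \<forall>B\<in>\<C>. J A B \<subseteq> K A B)"

definition cat_ideal_eq ::
  "('r, 'u) module set \<Rightarrow> ('r, 'u) hom_family \<Rightarrow> ('r, 'u) hom_family \<Rightarrow> bool" where
  "cat_ideal_eq \<C> J K \<longleftrightarrow> (\<forall>A\<in>\<C>. \<forall>B\<in>\<C>. J A B = K A B)"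

definition proper_cat_ideal ::
  "('r, 'x) ring_scheme \<Rightarrow> ('r, 'u) module set \<Rightarrow> ('r, 'u) hom_family \<Rightarrow> bool" where
  "proper_cat_ideal R \<C> J \<longleftrightarrow> cat_ideal R \<C> J \<and> \<not> cat_ideal_eq \<C> J (Hom R)"

definition maximal_cat_ideal ::
  "('r, 'x) ring_scheme \<Rightarrow> ('r, 'u) module set \<Rightarrow> ('r, 'u) hom_family \<Rightarrow> bool" where
  "maximal_cat_ideal R \<C> J \<longleftrightarrow> proper_cat_ideal R \<C> J \<and>
     (\<forall>K. proper_cat_ideal R \<C> K \<and> cat_ideal_le \<C> J K \<longrightarrow> cat_ideal_eq \<C> J K)"

definition associated_ideal ::
  "('r, 'x) ring_scheme \<Rightarrow> ('r, 'u) module \<Rightarrow> ('u \<Rightarrow> 'u) set \<Rightarrow> ('r, 'u) hom_family" where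
  "associated_ideal R F I X Y =
     {f \<in> Hom R X Y. \<forall>\<alpha>\<in>Hom R F X. \<forall>\<beta>\<in>Hom R Y F.
        compose (carrier F) \<beta> (compose (carrier F) f \<alpha>) \<in> I}"

end

theory Submission
  imports Defs
begin

text \<open>
  Because \<open>F\<close> is injective, \<open>F\<close> is a direct summand of \<open>M\<close> as soon as there is a monomorphism \<open>F \<rightarrow> M\<close>, and
  \<open>I\<close> consists of the endomorphisms of \<open>F\<close> that are not injective.  An ideal \<open>J\<close> of \<open>C\<^sub>F\<close> that does not
  contain \<open>1\<^sub>F\<close> is therefore contained in \<open>\<A>\<^sub>I\<close>.  An ideal that contains \<open>1\<^sub>F\<close> is determined, as far as
  identities are concerned, by the objects of rank \<open>0\<close>; since \<open>\<A>\<^sub>I\<close> contains their identities, \<open>\<A>\<^sub>I\<close> is maximal.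

  It remains to see that no maximal ideal \<open>J\<close> contains \<open>1\<^sub>F\<close>.  Otherwise \<open>1\<^sub>M \<notin> J\<close> for some \<open>M\<close> of rank \<open>0\<close>.
  For an infinite set \<open>W \<supseteq> M\<close> the sums of morphisms in \<open>J\<close> and morphisms with at most \<open>|W|\<close> values form an
  ideal containing \<open>J\<close> and \<open>1\<^sub>M\<close>.  It is proper: it does not contain the identity of the copower of \<open>M\<close>
  indexed by \<open>Pow W\<close>, which again has rank \<open>0\<close> because \<open>F\<close> is uniform.
\<close>

section \<open>Homomorphisms and submodules\<close>

text \<open>The obstacle to uniqueness is that properness of an ideal of \<open>C\<^sub>F\<close> is
  not witnessed by one fixed identity: a union of a chain of proper ideals may be everything, so a
  proper ideal need not lie in a maximal one. Ideals containing 1_F are therefore not compared with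
  anything; each proper one is shown to be strictly enlargeable. This is why objects of rank 0 must
  exist in ever larger sizes and where closure of the universe under power sets enters: against the
  bound |W| a copower with more than |W| coordinates is needed, and Cantor's theorem supplies 2^|W|.
  Elements of a direct sum have finite support, so at most |W| of them involve at most |W|
  coordinates.

  Everything about I is read off from kernels. Nonzero submodules of F meet nontrivially, so maps
  out of F with nonzero kernel are closed under addition, whatever their codomain. Inside End(F)
  this makes the non-injective maps an ideal, which maximality then identifies with I; in the
  category it gives additivity of the associated ideal.\<close>

lemma (in right_module) smult_r_null:
  assumes "a \<in> carrier R" shows "a \<odot>\<^bsub>M\<^esub> \<zero>\<^bsub>M\<^esub> = \<zero>\<^bsub>M\<^esub>"
proof -
  have "a \<odot>\<^bsub>M\<^esub> \<zero>\<^bsub>M\<^esub> \<oplus>\<^bsub>M\<^esub> a \<odot>\<^bsub>M\<^esub> \<zero>\<^bsub>M\<^esub> = a \<odot>\<^bsub>M\<^esub> \<zero>\<^bsub>M\<^esub>"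
    using assms smult_r_distr[of a "\<zero>\<^bsub>M\<^esub>" "\<zero>\<^bsub>M\<^esub>"] by simp
  then show ?thesis using assms smult_closed[of a "\<zero>\<^bsub>M\<^esub>"] by simp
qed

lemma HomI:
  assumes "\<And>x. x \<in> carrier M \<Longrightarrow> f x \<in> carrier N"
    and "\<And>x y. \<lbrakk>x \<in> carrier M; y \<in> carrier M\<rbrakk> \<Longrightarrow> f (x \<oplus>\<^bsub>M\<^esub> y) = f x \<oplus>\<^bsub>N\<^esub> f y"
    and "\<And>a x. \<lbrakk>a \<in> carrier R; x \<in> carrier M\<rbrakk> \<Longrightarrow> f (a \<odot>\<^bsub>M\<^esub> x) = a \<odot>\<^bsub>N\<^esub> f x"
    and "f \<in> extensional (carrier M)"
  shows "f \<in> Hom R M N"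
  using assms by (auto simp: Hom_def PiE_def)

lemma Hom_closed: "\<lbrakk>f \<in> Hom R M N; x \<in> carrier M\<rbrakk> \<Longrightarrow> f x \<in> carrier N"
  and Hom_add: "\<lbrakk>f \<in> Hom R M N; x \<in> carrier M; y \<in> carrier M\<rbrakk> \<Longrightarrow> f (x \<oplus>\<^bsub>M\<^esub> y) = f x \<oplus>\<^bsub>N\<^esub> f y"
  and Hom_smult: "\<lbrakk>f \<in> Hom R M N; a \<in> carrier R; x \<in> carrier M\<rbrakk> \<Longrightarrow> f (a \<odot>\<^bsub>M\<^esub> x) = a \<odot>\<^bsub>N\<^esub> f x"
  by (auto simp: Hom_def)

lemma Hom_eqI:
  assumes "f \<in> Hom R M N" "g \<in> Hom R M N" "\<And>x. x \<in> carrier M \<Longrightarrow> f x = g x"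
  shows "f = g"
  by (rule extensionalityI[of _ "carrier M"]) (use assms in \<open>auto simp: Hom_def PiE_def\<close>)

lemma restrict_HomI:
  assumes "right_module R M"
    and "\<And>x. x \<in> carrier M \<Longrightarrow> f x \<in> carrier N"
    and "\<And>x y. \<lbrakk>x \<in> carrier M; y \<in> carrier M\<rbrakk> \<Longrightarrow> f (x \<oplus>\<^bsub>M\<^esub> y) = f x \<oplus>\<^bsub>N\<^esub> f y"
    and "\<And>a x. \<lbrakk>a \<in> carrier R; x \<in> carrier M\<rbrakk> \<Longrightarrow> f (a \<odot>\<^bsub>M\<^esub> x) = a \<odot>\<^bsub>N\<^esub> f x"
  shows "restrict f (carrier M) \<in> Hom R M N"
proof -
  interpret right_module R M by fact
  show ?thesis
    by (rule HomI) (auto simp: assms smult_closed)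
qed

lemma Hom_compose:
  assumes "right_module R A" "f \<in> Hom R A B" "g \<in> Hom R B C"
  shows "compose (carrier A) g f \<in> Hom R A C"
  unfolding compose_def using assms
  by (intro restrict_HomI) (auto simp: Hom_closed Hom_add Hom_smult)

lemma Hom_id: "right_module R A \<Longrightarrow> (\<lambda>x\<in>carrier A. x) \<in> Hom R A A"
  by (rule restrict_HomI) auto

lemma Hom_zero:
  assumes "right_module R M" "right_module R N" "f \<in> Hom R M N"
  shows "f \<zero>\<^bsub>M\<^esub> = \<zero>\<^bsub>N\<^esub>"
proof -
  interpret M: right_module R M by fact
  interpret N: right_module R N by fact
  have "f \<zero>\<^bsub>M\<^esub> \<oplus>\<^bsub>N\<^esub> f \<zero>\<^bsub>M\<^esub> = f \<zero>\<^bsub>M\<^esub>"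
    using Hom_add[OF assms(3), of "\<zero>\<^bsub>M\<^esub>" "\<zero>\<^bsub>M\<^esub>"] by simp
  then show ?thesis
    using Hom_closed[OF assms(3)] by (metis M.M.zero_closed N.M.add.r_cancel_one)
qed

lemma Hom_a_inv:
  assumes "right_module R M" "right_module R N" "f \<in> Hom R M N" "x \<in> carrier M"
  shows "f (\<ominus>\<^bsub>M\<^esub> x) = \<ominus>\<^bsub>N\<^esub> f x"
proof -
  interpret M: right_module R M by fact
  interpret N: right_module R N by fact
  have "f (\<ominus>\<^bsub>M\<^esub> x) \<oplus>\<^bsub>N\<^esub> f x = \<zero>\<^bsub>N\<^esub>"
    using Hom_add[OF assms(3), of "\<ominus>\<^bsub>M\<^esub> x" x] assms(4) Hom_zero[OF assms(1-3)]
    by (simp add: M.M.l_neg)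
  then show ?thesis
    using Hom_closed[OF assms(3)] assms(4) by (simp add: N.M.minus_equality)
qed

lemma (in abelian_group) minus_eq_zero_iff:
  assumes "x \<in> carrier G" "y \<in> carrier G"
  shows "x \<ominus> y = \<zero> \<longleftrightarrow> x = y"
  using assms minus_equality[of x "\<ominus> y"] by (auto simp: a_minus_def r_neg)

lemma Hom_minus:
  assumes "right_module R M" "right_module R N" "f \<in> Hom R M N" "x \<in> carrier M" "y \<in> carrier M"
  shows "f (x \<ominus>\<^bsub>M\<^esub> y) = f x \<ominus>\<^bsub>N\<^esub> f y"
proof -
  interpret M: right_module R M by fact
  show ?thesis
    using assms by (simp add: a_minus_def Hom_add[OF assms(3)] Hom_a_inv[OF assms(1-3)])
qed

lemma inj_on_Hom_iff:
  assumes "right_module R M" "right_module R N" "f \<in> Hom R M N"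
  shows "inj_on f (carrier M) \<longleftrightarrow> (\<forall>x\<in>carrier M. f x = \<zero>\<^bsub>N\<^esub> \<longrightarrow> x = \<zero>\<^bsub>M\<^esub>)"
proof -
  interpret M: right_module R M by fact
  interpret N: right_module R N by fact
  show ?thesis
  proof
    assume "inj_on f (carrier M)"
    then show "\<forall>x\<in>carrier M. f x = \<zero>\<^bsub>N\<^esub> \<longrightarrow> x = \<zero>\<^bsub>M\<^esub>"
      using Hom_zero[OF assms] by (metis M.M.zero_closed inj_onD)
  next
    assume *: "\<forall>x\<in>carrier M. f x = \<zero>\<^bsub>N\<^esub> \<longrightarrow> x = \<zero>\<^bsub>M\<^esub>"
    show "inj_on f (carrier M)"
    proof (rule inj_onI)
      fix x y assume xy: "x \<in> carrier M" "y \<in> carrier M" "f x = f y"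
      then have "f (x \<ominus>\<^bsub>M\<^esub> y) = \<zero>\<^bsub>N\<^esub>"
        using Hom_closed[OF assms(3)] by (simp add: Hom_minus[OF assms] N.M.minus_eq_zero_iff)
      moreover have "x \<ominus>\<^bsub>M\<^esub> y \<in> carrier M" using xy by simp
      ultimately show "x = y" using * M.M.minus_eq_zero_iff[OF xy(1,2)] by blast
    qed
  qed
qed

section \<open>The additive group of homomorphisms\<close>

lemma Hom_group_comm_group:
  assumes "right_module R A" "right_module R B"
  shows "comm_group (Hom_group R A B)"
proof -
  interpret A: right_module R A by fact
  interpret B: right_module R B by fact
  have inv: "(\<lambda>x\<in>carrier A. \<ominus>\<^bsub>B\<^esub> f x) \<in> Hom R A B" if "f \<in> Hom R A B" for f
  proof (rule restrict_HomI[OF assms(1)])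
    fix a x assume ax: "a \<in> carrier R" "x \<in> carrier A"
    have "f (a \<odot>\<^bsub>A\<^esub> (\<ominus>\<^bsub>A\<^esub> x)) = a \<odot>\<^bsub>B\<^esub> (\<ominus>\<^bsub>B\<^esub> f x)"
      using ax that by (simp add: Hom_smult Hom_a_inv[OF assms])
    moreover have "a \<odot>\<^bsub>A\<^esub> (\<ominus>\<^bsub>A\<^esub> x) = \<ominus>\<^bsub>A\<^esub> (a \<odot>\<^bsub>A\<^esub> x)"
    proof -
      have "a \<odot>\<^bsub>A\<^esub> (\<ominus>\<^bsub>A\<^esub> x) \<oplus>\<^bsub>A\<^esub> a \<odot>\<^bsub>A\<^esub> x = \<zero>\<^bsub>A\<^esub>"
        using A.smult_r_distr[of a "\<ominus>\<^bsub>A\<^esub> x" x] ax by (simp add: A.M.l_neg A.smult_r_null)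
      then show ?thesis using ax A.smult_closed by (intro A.M.minus_equality[symmetric]) simp_all
    qed
    ultimately show "\<ominus>\<^bsub>B\<^esub> f (a \<odot>\<^bsub>A\<^esub> x) = a \<odot>\<^bsub>B\<^esub> (\<ominus>\<^bsub>B\<^esub> f x)"
      using Hom_a_inv[OF assms that, of "a \<odot>\<^bsub>A\<^esub> x"] ax A.smult_closed by simp
  qed (use that in \<open>auto simp: Hom_add Hom_closed B.M.minus_add\<close>)
  have add: "(\<lambda>x\<in>carrier A. f x \<oplus>\<^bsub>B\<^esub> g x) \<in> Hom R A B" if "f \<in> Hom R A B" "g \<in> Hom R A B" for f g
    using that by (intro restrict_HomI[OF assms(1)])
      (auto simp: Hom_add Hom_closed Hom_smult B.smult_r_distr B.M.a_ac)
  have zero: "(\<lambda>x\<in>carrier A. \<zero>\<^bsub>B\<^esub>) \<in> Hom R A B"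
    by (rule restrict_HomI[OF assms(1)]) (auto simp: B.smult_r_null)
  show ?thesis
  proof (rule comm_groupI; unfold Hom_group_def partial_object.simps monoid.simps)
    fix f g h assume "f \<in> Hom R A B" "g \<in> Hom R A B" "h \<in> Hom R A B"
    then show "(\<lambda>x\<in>carrier A. (\<lambda>x\<in>carrier A. f x \<oplus>\<^bsub>B\<^esub> g x) x \<oplus>\<^bsub>B\<^esub> h x) =
       (\<lambda>x\<in>carrier A. f x \<oplus>\<^bsub>B\<^esub> (\<lambda>x\<in>carrier A. g x \<oplus>\<^bsub>B\<^esub> h x) x)"
      by (auto simp: Hom_closed B.M.a_assoc intro!: restrict_ext)
  next
    fix f g assume "f \<in> Hom R A B" "g \<in> Hom R A B"
    then show "(\<lambda>x\<in>carrier A. f x \<oplus>\<^bsub>B\<^esub> g x) = (\<lambda>x\<in>carrier A. g x \<oplus>\<^bsub>B\<^esub> f x)"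
      by (auto simp: Hom_closed B.M.a_comm intro!: restrict_ext)
  next
    fix f assume f: "f \<in> Hom R A B"
    then show "(\<lambda>x\<in>carrier A. (\<lambda>x\<in>carrier A. \<zero>\<^bsub>B\<^esub>) x \<oplus>\<^bsub>B\<^esub> f x) = f"
      by (intro Hom_eqI[OF add[OF zero f] f]) (auto simp: Hom_closed)
    show "\<exists>y\<in>Hom R A B. (\<lambda>x\<in>carrier A. y x \<oplus>\<^bsub>B\<^esub> f x) = (\<lambda>x\<in>carrier A. \<zero>\<^bsub>B\<^esub>)"
      using inv[OF f] f
      by (intro bexI[of _ "\<lambda>x\<in>carrier A. \<ominus>\<^bsub>B\<^esub> f x"])
        (auto simp: Hom_closed B.M.l_neg intro!: restrict_ext)
  qed (use add zero in auto)
qed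

lemma Hom_add_closed:
  assumes "right_module R A" "right_module R B" "f \<in> Hom R A B" "g \<in> Hom R A B"
  shows "(\<lambda>x\<in>carrier A. f x \<oplus>\<^bsub>B\<^esub> g x) \<in> Hom R A B"
proof -
  interpret comm_group "Hom_group R A B" using assms by (intro Hom_group_comm_group)
  show ?thesis using m_closed[of f g] assms by (simp add: Hom_group_def)
qed

lemma Hom_zero_closed:
  assumes "right_module R A" "right_module R B"
  shows "(\<lambda>x\<in>carrier A. \<zero>\<^bsub>B\<^esub>) \<in> Hom R A B"
proof -
  interpret comm_group "Hom_group R A B" using assms by (intro Hom_group_comm_group)
  show ?thesis using one_closed by (simp add: Hom_group_def)
qed

text \<open>\<open>cat_ideal\<close> speaks of subgroups of \<open>Hom_group\<close>, whose inverse
  is only characterised abstractly. Evaluating \<open>l_inv\<close> at a point identifies it with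
  the pointwise negative.\<close>

lemma inv_Hom_group:
  assumes "right_module R A" "right_module R B" "f \<in> Hom R A B"
  shows "inv\<^bsub>Hom_group R A B\<^esub> f \<in> Hom R A B"
    and "x \<in> carrier A \<Longrightarrow> (inv\<^bsub>Hom_group R A B\<^esub> f) x = \<ominus>\<^bsub>B\<^esub> f x"
proof -
  interpret B: right_module R B by fact
  interpret comm_group "Hom_group R A B" using assms by (intro Hom_group_comm_group)
  have f: "f \<in> carrier (Hom_group R A B)" using assms by (simp add: Hom_group_def)
  show *: "inv\<^bsub>Hom_group R A B\<^esub> f \<in> Hom R A B"
    using inv_closed[OF f] by (simp add: Hom_group_def)
  assume x: "x \<in> carrier A"
  have "(\<lambda>x\<in>carrier A. (inv\<^bsub>Hom_group R A B\<^esub> f) x \<oplus>\<^bsub>B\<^esub> f x) = (\<lambda>x\<in>carrier A. \<zero>\<^bsub>B\<^esub>)"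
    using l_inv[OF f] by (simp add: Hom_group_def)
  from fun_cong[OF this, of x] have "(inv\<^bsub>Hom_group R A B\<^esub> f) x \<oplus>\<^bsub>B\<^esub> f x = \<zero>\<^bsub>B\<^esub>"
    using x by simp
  then show "(inv\<^bsub>Hom_group R A B\<^esub> f) x = \<ominus>\<^bsub>B\<^esub> f x"
    using x Hom_closed[OF *] Hom_closed[OF assms(3)] B.M.minus_equality by simp
qed

section \<open>Submodules, kernels and images\<close>

lemma right_submoduleI:
  assumes "right_module R M" "H \<subseteq> carrier M" "\<zero>\<^bsub>M\<^esub> \<in> H"
    and "\<And>a b. \<lbrakk>a \<in> H; b \<in> H\<rbrakk> \<Longrightarrow> a \<oplus>\<^bsub>M\<^esub> b \<in> H"
    and smult: "\<And>a x. \<lbrakk>a \<in> carrier R; x \<in> H\<rbrakk> \<Longrightarrow> a \<odot>\<^bsub>M\<^esub> x \<in> H"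
  shows "submodule H R M"
proof -
  interpret right_module R M by fact
  \<comment> \<open>Closure under negatives comes for free: it is multiplication by the scalar
    -1.\<close>
  have "\<ominus>\<^bsub>M\<^esub> x \<in> H" if "x \<in> H" for x
  proof -
    have x: "x \<in> carrier M" using assms that by auto
    have "\<zero>\<^bsub>R\<^esub> \<odot>\<^bsub>M\<^esub> x = \<zero>\<^bsub>M\<^esub>"
      using smult_l_distr[OF R.zero_closed R.zero_closed x] smult_closed[OF R.zero_closed x]
      by (metis M.add.r_cancel_one R.l_zero R.zero_closed)
    then have "(\<ominus>\<^bsub>R\<^esub> \<one>\<^bsub>R\<^esub>) \<odot>\<^bsub>M\<^esub> x \<oplus>\<^bsub>M\<^esub> x = \<zero>\<^bsub>M\<^esub>"
      using smult_l_distr[of "\<ominus>\<^bsub>R\<^esub> \<one>\<^bsub>R\<^esub>" "\<one>\<^bsub>R\<^esub>" x] x smult_one[OF x] by (simp add: R.l_neg)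
    then have "(\<ominus>\<^bsub>R\<^esub> \<one>\<^bsub>R\<^esub>) \<odot>\<^bsub>M\<^esub> x = \<ominus>\<^bsub>M\<^esub> x"
      using x smult_closed M.minus_equality by simp
    then show ?thesis using smult[of "\<ominus>\<^bsub>R\<^esub> \<one>\<^bsub>R\<^esub>" x] that by simp
  qed
  then show ?thesis using assms
    by (intro submodule.intro subgroup.intro submodule_axioms.intro) (auto simp: a_inv_def)
qed

lemma submoduleD:
  assumes "submodule H R M"
  shows "H \<subseteq> carrier M" and "\<zero>\<^bsub>M\<^esub> \<in> H"
    and "\<lbrakk>a \<in> H; b \<in> H\<rbrakk> \<Longrightarrow> a \<oplus>\<^bsub>M\<^esub> b \<in> H"
    and "a \<in> H \<Longrightarrow> \<ominus>\<^bsub>M\<^esub> a \<in> H"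
    and "\<lbrakk>r \<in> carrier R; a \<in> H\<rbrakk> \<Longrightarrow> r \<odot>\<^bsub>M\<^esub> a \<in> H"
proof -
  interpret submodule H R M by fact
  show "H \<subseteq> carrier M" using subset by simp
  show "\<zero>\<^bsub>M\<^esub> \<in> H" using one_closed by simp
  show "\<lbrakk>a \<in> H; b \<in> H\<rbrakk> \<Longrightarrow> a \<oplus>\<^bsub>M\<^esub> b \<in> H" using m_closed by simp
  show "a \<in> H \<Longrightarrow> \<ominus>\<^bsub>M\<^esub> a \<in> H" using m_inv_closed by (simp add: a_inv_def)
  show "\<lbrakk>r \<in> carrier R; a \<in> H\<rbrakk> \<Longrightarrow> r \<odot>\<^bsub>M\<^esub> a \<in> H" using smult_closed by simp
qed

lemma submodule_carrier:
  assumes "right_module R M"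
  shows "submodule (carrier M) R M"
proof -
  interpret right_module R M by fact
  show ?thesis by (rule right_submoduleI) (auto simp: assms smult_closed)
qed

lemma right_module_submodule:
  assumes "right_module R M" "submodule H R M"
  shows "right_module R (M\<lparr>carrier := H\<rparr>)"
proof -
  interpret right_module R M by fact
  note H = submoduleD[OF assms(2)]
  have "abelian_group (M\<lparr>carrier := H\<rparr>)"
  proof (rule abelian_groupI)
    fix x assume "x \<in> carrier (M\<lparr>carrier := H\<rparr>)"
    then show "\<exists>y\<in>carrier (M\<lparr>carrier := H\<rparr>). y \<oplus>\<^bsub>M\<lparr>carrier := H\<rparr>\<^esub> x = \<zero>\<^bsub>M\<lparr>carrier := H\<rparr>\<^esub>"
      using H by (intro bexI[of _ "\<ominus>\<^bsub>M\<^esub> x"]) (auto simp: M.l_neg)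
  qed (use H in \<open>auto simp: M.a_ac subsetD\<close>)
  moreover have "right_module_axioms R (M\<lparr>carrier := H\<rparr>)"
    using H by unfold_locales (auto simp: smult_l_distr smult_r_distr smult_assoc smult_one subsetD)
  ultimately show ?thesis
    by (intro right_module.intro) (rule R.ring_axioms)
qed

lemma Hom_inclusion:
  assumes "right_module R M" "submodule H R M"
  shows "(\<lambda>x\<in>H. x) \<in> Hom R (M\<lparr>carrier := H\<rparr>) M"
proof -
  note H = submoduleD[OF assms(2)]
  show ?thesis
    by (rule HomI) (use H in auto)
qed

lemma small_subset: "\<lbrakk>small U B; A \<subseteq> B\<rbrakk> \<Longrightarrow> small U A"
  unfolding small_def using card_of_mono1 ordLeq_ordLess_trans by blast

lemma carrier_update_carrier [simp]: "M\<lparr>carrier := carrier M\<rparr> = M"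
  by simp

lemma right_module_small_modules: "M \<in> small_modules R \<Longrightarrow> right_module R M"
  by (simp add: small_modules_def)

lemma small_modules_submodule:
  fixes M :: "('r, 'u) module"
  assumes "M \<in> small_modules R" "submodule H R M"
  shows "M\<lparr>carrier := H\<rparr> \<in> small_modules R"
  using assms right_module_submodule[of R M H] small_subset[of "TYPE('u)" "carrier M" H] submoduleD(1)[OF assms(2)]
  by (auto simp: small_modules_def)

text \<open>The definition of \<open>injective\<close> is applied to the inclusion of
  \<open>H\<close>, which is small as a subset of a small carrier.\<close>

lemma injective_extend:
  fixes M E :: "('r, 'u) module"
  assumes "injective R E" "M \<in> small_modules R" "submodule H R M" "g \<in> Hom R (M\<lparr>carrier := H\<rparr>) E"
  obtains h where "h \<in> Hom R M E" "\<And>x. x \<in> H \<Longrightarrow> h x = g x"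
proof -
  have "right_module R M" using assms by (simp add: small_modules_def)
  then have incl: "(\<lambda>x\<in>H. x) \<in> Hom R (M\<lparr>carrier := H\<rparr>) M"
    using assms(3) by (rule Hom_inclusion)
  have "inj_on (\<lambda>x\<in>H. x) (carrier (M\<lparr>carrier := H\<rparr>))" by (simp add: inj_on_def)
  from assms(1)[unfolded injective_def, rule_format, OF small_modules_submodule[OF assms(2,3)] assms(2) incl this assms(4)]
  obtain h where h: "h \<in> Hom R M E" "compose (carrier (M\<lparr>carrier := H\<rparr>)) h (\<lambda>x\<in>H. x) = g" ..
  have "h x = g x" if "x \<in> H" for x
    using fun_cong[OF h(2), of x] that by (simp add: compose_def)
  then show ?thesis by (rule that[OF h(1)])
qed

lemma submodule_singleton_zero: 
  assumes "right_module R M" shows "submodule {\<zero>\<^bsub>M\<^esub>} R M"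
proof -
  interpret right_module R M by fact
  show ?thesis by (rule right_submoduleI) (auto simp: assms smult_r_null)
qed

lemma submodule_vimage:
  assumes "right_module R M" "right_module R N" "f \<in> Hom R M N" "submodule H R N"
  shows "submodule {x \<in> carrier M. f x \<in> H} R M"
proof -
  interpret M: right_module R M by fact
  note H = submoduleD[OF assms(4)]
  show ?thesis
    by (rule right_submoduleI)
      (use H assms in \<open>auto simp: Hom_zero[OF assms(1-3)] Hom_add[OF assms(3)] Hom_smult[OF assms(3)] M.smult_closed\<close>)
qed

lemma submodule_kernel:
  assumes "right_module R M" "right_module R N" "f \<in> Hom R M N"
  shows "submodule {x \<in> carrier M. f x = \<zero>\<^bsub>N\<^esub>} R M"
  using submodule_vimage[OF assms submodule_singleton_zero[OF assms(2)]] by simp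

lemma submodule_image:
  assumes "right_module R M" "right_module R N" "f \<in> Hom R M N"
  shows "submodule (f ` carrier M) R N"
proof -
  interpret M: right_module R M by fact
  show ?thesis
  proof (rule right_submoduleI)
    show "\<zero>\<^bsub>N\<^esub> \<in> f ` carrier M"
      using Hom_zero[OF assms] by (metis M.M.zero_closed imageI)
  next
    fix a b assume "a \<in> f ` carrier M" "b \<in> f ` carrier M"
    then show "a \<oplus>\<^bsub>N\<^esub> b \<in> f ` carrier M"
      by (auto simp flip: Hom_add[OF assms(3)])
  next
    fix a x assume "a \<in> carrier R" "x \<in> f ` carrier M"
    then show "a \<odot>\<^bsub>N\<^esub> x \<in> f ` carrier M"
      by (auto simp: M.smult_closed simp flip: Hom_smult[OF assms(3)])
  qed (use assms in \<open>auto simp: Hom_closed\<close>)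
qed

lemma Hom_codomain:
  assumes "f \<in> Hom R M N" "\<And>x. x \<in> carrier M \<Longrightarrow> f x \<in> H"
  shows "f \<in> Hom R M (N\<lparr>carrier := H\<rparr>)"
  using assms by (auto simp: Hom_def PiE_def)

lemma Hom_inverse:
  assumes "right_module R M" "right_module R N" "f \<in> Hom R M N" "bij_betw f (carrier M) (carrier N)"
  obtains g where "g \<in> Hom R N M" "bij_betw g (carrier N) (carrier M)"
    "\<And>x. x \<in> carrier M \<Longrightarrow> g (f x) = x" "\<And>y. y \<in> carrier N \<Longrightarrow> f (g y) = y"
proof
  interpret M: right_module R M by fact
  interpret N: right_module R N by fact
  let ?g = "\<lambda>y\<in>carrier N. inv_into (carrier M) f y"
  have inj: "inj_on f (carrier M)" and im: "f ` carrier M = carrier N"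
    using assms(4) by (auto simp: bij_betw_def)
  show gf: "?g (f x) = x" if "x \<in> carrier M" for x
    using inj that im by auto
  show fg: "f (?g y) = y" if "y \<in> carrier N" for y
    using that im by (simp add: f_inv_into_f)
  have cl: "?g y \<in> carrier M" if "y \<in> carrier N" for y
    using that im by (simp add: inv_into_into)
  show "?g \<in> Hom R N M"
  proof (rule HomI)
    fix x y assume xy: "x \<in> carrier N" "y \<in> carrier N"
    have "f (?g x \<oplus>\<^bsub>M\<^esub> ?g y) = x \<oplus>\<^bsub>N\<^esub> y"
      by (simp only: Hom_add[OF assms(3) cl[OF xy(1)] cl[OF xy(2)]] fg[OF xy(1)] fg[OF xy(2)])
    then show "?g (x \<oplus>\<^bsub>N\<^esub> y) = ?g x \<oplus>\<^bsub>M\<^esub> ?g y"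
      using gf[of "?g x \<oplus>\<^bsub>M\<^esub> ?g y"] cl[OF xy(1)] cl[OF xy(2)] by (metis M.M.a_closed)
  next
    fix a x assume ax: "a \<in> carrier R" "x \<in> carrier N"
    have "f (a \<odot>\<^bsub>M\<^esub> ?g x) = a \<odot>\<^bsub>N\<^esub> x"
      by (simp only: Hom_smult[OF assms(3) ax(1) cl[OF ax(2)]] fg[OF ax(2)])
    then show "?g (a \<odot>\<^bsub>N\<^esub> x) = a \<odot>\<^bsub>M\<^esub> ?g x"
      using gf[of "a \<odot>\<^bsub>M\<^esub> ?g x"] ax cl[OF ax(2)] by (metis M.smult_closed)
  qed (use cl in auto)
  show "bij_betw ?g (carrier N) (carrier M)"
    using assms(3,4) cl gf fg by (intro bij_betw_byWitness[where f'=f]) (auto simp: Hom_closed)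
qed

section \<open>Direct decompositions and maximal disjoint submodules\<close>

lemma summand_of_retraction:
  assumes "right_module R N" "right_module R M"
    and "\<alpha> \<in> Hom R N M" "h \<in> Hom R M N" "\<And>x. x \<in> carrier N \<Longrightarrow> h (\<alpha> x) = x"
  shows "internal_direct_sum R M (\<alpha> ` carrier N) {x \<in> carrier M. h x = \<zero>\<^bsub>N\<^esub>}"
proof -
  interpret N: right_module R N by fact
  interpret M: right_module R M by fact
  note \<alpha> = Hom_closed[OF assms(3)] note h = Hom_closed[OF assms(4)]
  have "\<exists>a\<in>\<alpha> ` carrier N. \<exists>b\<in>{x \<in> carrier M. h x = \<zero>\<^bsub>N\<^esub>}. x = a \<oplus>\<^bsub>M\<^esub> b" if x: "x \<in> carrier M" for x
  proof (intro bexI)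
    \<comment> \<open>The decomposition defined by the idempotent \<alpha> h: its image and its
      kernel.\<close>
    show "x = \<alpha> (h x) \<oplus>\<^bsub>M\<^esub> (x \<ominus>\<^bsub>M\<^esub> \<alpha> (h x))"
      using x \<alpha> h by (simp add: a_minus_def M.M.a_lcomm M.M.r_neg)
    show "x \<ominus>\<^bsub>M\<^esub> \<alpha> (h x) \<in> {x \<in> carrier M. h x = \<zero>\<^bsub>N\<^esub>}"
      using x \<alpha> h by (simp add: Hom_minus[OF assms(2,1,4)] assms(5) N.M.r_neg a_minus_def[of N])
  qed (use x h in auto)
  moreover have "\<alpha> ` carrier N \<inter> {x \<in> carrier M. h x = \<zero>\<^bsub>N\<^esub>} = {\<zero>\<^bsub>M\<^esub>}"
    using Hom_zero[OF assms(1-3)] Hom_zero[OF assms(2,1,4)] assms(5) by (force simp: image_iff)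
  ultimately show ?thesis
    using submodule_image[OF assms(1-3)] submodule_kernel[OF assms(2,1,4)]
    by (simp add: internal_direct_sum_def)
qed

text \<open>If a + b = c + d then a - c = d - b lies in both submodules, hence is zero. So the first
  component is well defined and can be picked by a definite description.\<close>

lemma submodule_sum_projection:
  assumes "right_module R M" "submodule A R M" "submodule B R M" "A \<inter> B = {\<zero>\<^bsub>M\<^esub>}"
  defines "S \<equiv> {a \<oplus>\<^bsub>M\<^esub> b |a b. a \<in> A \<and> b \<in> B}"
  obtains p where "submodule S R M" "p \<in> Hom R (M\<lparr>carrier := S\<rparr>) (M\<lparr>carrier := A\<rparr>)"
    "\<And>a b. \<lbrakk>a \<in> A; b \<in> B\<rbrakk> \<Longrightarrow> p (a \<oplus>\<^bsub>M\<^esub> b) = a"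
proof
  interpret right_module R M by fact
  note A = submoduleD[OF assms(2)] and B = submoduleD[OF assms(3)]
  have car: "a \<in> carrier M" if "a \<in> A \<or> a \<in> B" for a using A(1) B(1) that by auto
  have add: "(a \<oplus>\<^bsub>M\<^esub> b) \<oplus>\<^bsub>M\<^esub> (c \<oplus>\<^bsub>M\<^esub> d) = (a \<oplus>\<^bsub>M\<^esub> c) \<oplus>\<^bsub>M\<^esub> (b \<oplus>\<^bsub>M\<^esub> d)"
    if "a \<in> A" "b \<in> B" "c \<in> A" "d \<in> B" for a b c d
    using that car by (simp add: M.a_ac)
  have smult: "r \<odot>\<^bsub>M\<^esub> (a \<oplus>\<^bsub>M\<^esub> b) = r \<odot>\<^bsub>M\<^esub> a \<oplus>\<^bsub>M\<^esub> r \<odot>\<^bsub>M\<^esub> b"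
    if "a \<in> A" "b \<in> B" "r \<in> carrier R" for a b r
    using that car by (simp add: smult_r_distr)
  show S: "submodule S R M"
  proof (rule right_submoduleI)
    show "\<zero>\<^bsub>M\<^esub> \<in> S" unfolding S_def using A(2) B(2) by (auto intro!: exI[of _ "\<zero>\<^bsub>M\<^esub>"])
    show "x \<oplus>\<^bsub>M\<^esub> y \<in> S" if xy: "x \<in> S" "y \<in> S" for x y
    proof -
      obtain a b c d where *: "a \<in> A" "b \<in> B" "c \<in> A" "d \<in> B" "x = a \<oplus>\<^bsub>M\<^esub> b" "y = c \<oplus>\<^bsub>M\<^esub> d"
        using xy by (auto simp: S_def)
      then show ?thesis unfolding S_def using add[OF *(1-4)] A(3)[of a c] B(3)[of b d] by auto
    qed
    show "r \<odot>\<^bsub>M\<^esub> x \<in> S" if x: "x \<in> S" "r \<in> carrier R" for x r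
    proof -
      obtain a b where *: "a \<in> A" "b \<in> B" "x = a \<oplus>\<^bsub>M\<^esub> b" using x by (auto simp: S_def)
      then show ?thesis unfolding S_def using smult[OF *(1,2) x(2)] A(5)[of r a] B(5)[of r b] x(2) by auto
    qed
  qed (use car assms(1) in \<open>auto simp: S_def\<close>)
  have unique: "a = c" if *: "a \<in> A" "b \<in> B" "c \<in> A" "d \<in> B" and eq: "a \<oplus>\<^bsub>M\<^esub> b = c \<oplus>\<^bsub>M\<^esub> d" for a b c d
  proof -
    have "a \<ominus>\<^bsub>M\<^esub> c = (a \<oplus>\<^bsub>M\<^esub> b) \<ominus>\<^bsub>M\<^esub> (c \<oplus>\<^bsub>M\<^esub> b)"
      using * car by (simp add: a_minus_def M.minus_add M.a_ac M.r_neg1 M.r_neg2)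
    also have "\<dots> = (c \<oplus>\<^bsub>M\<^esub> \<ominus>\<^bsub>M\<^esub> c) \<oplus>\<^bsub>M\<^esub> (d \<ominus>\<^bsub>M\<^esub> b)"
      unfolding eq using * car by (simp add: a_minus_def M.minus_add M.a_ac)
    also have "\<dots> = d \<ominus>\<^bsub>M\<^esub> b"
      using * car by (simp add: M.r_neg)
    finally have "a \<ominus>\<^bsub>M\<^esub> c \<in> A \<inter> B"
      using * A(3,4) B(3,4) by (metis IntI a_minus_def)
    then show ?thesis using * car assms(4) M.minus_eq_zero_iff[of a c] by simp
  qed
  let ?p = "\<lambda>x\<in>S. THE a. a \<in> A \<and> (\<exists>b\<in>B. x = a \<oplus>\<^bsub>M\<^esub> b)"
  show p: "?p (a \<oplus>\<^bsub>M\<^esub> b) = a" if "a \<in> A" "b \<in> B" for a b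
  proof -
    have "(THE a'. a' \<in> A \<and> (\<exists>b'\<in>B. a \<oplus>\<^bsub>M\<^esub> b = a' \<oplus>\<^bsub>M\<^esub> b')) = a"
      by (rule the_equality) (use that unique in auto)
    moreover have "a \<oplus>\<^bsub>M\<^esub> b \<in> S" using that by (auto simp: S_def)
    ultimately show ?thesis by simp
  qed
  show "?p \<in> Hom R (M\<lparr>carrier := S\<rparr>) (M\<lparr>carrier := A\<rparr>)"
  proof (rule HomI)
    fix x assume "x \<in> carrier (M\<lparr>carrier := S\<rparr>)"
    then obtain a b where "a \<in> A" "b \<in> B" "x = a \<oplus>\<^bsub>M\<^esub> b" by (auto simp: S_def)
    then show "?p x \<in> carrier (M\<lparr>carrier := A\<rparr>)" using p by simp
  next
    fix x y assume "x \<in> carrier (M\<lparr>carrier := S\<rparr>)" "y \<in> carrier (M\<lparr>carrier := S\<rparr>)"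
    then obtain a b c d where *: "a \<in> A" "b \<in> B" "c \<in> A" "d \<in> B" "x = a \<oplus>\<^bsub>M\<^esub> b" "y = c \<oplus>\<^bsub>M\<^esub> d"
      by (auto simp: S_def)
    have "?p (x \<oplus>\<^bsub>M\<^esub> y) = a \<oplus>\<^bsub>M\<^esub> c"
      unfolding *(5,6) add[OF *(1-4)] using * A(3) B(3) by (intro p)
    then show "?p (x \<oplus>\<^bsub>M\<lparr>carrier := S\<rparr>\<^esub> y) = ?p x \<oplus>\<^bsub>M\<lparr>carrier := A\<rparr>\<^esub> ?p y"
      unfolding *(5,6) p[OF *(1,2)] p[OF *(3,4)] by simp
  next
    fix r x assume rx: "r \<in> carrier R" "x \<in> carrier (M\<lparr>carrier := S\<rparr>)"
    then obtain a b where *: "a \<in> A" "b \<in> B" "x = a \<oplus>\<^bsub>M\<^esub> b" by (auto simp: S_def)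
    have "?p (r \<odot>\<^bsub>M\<^esub> x) = r \<odot>\<^bsub>M\<^esub> a"
      unfolding *(3) smult[OF *(1,2) rx(1)] using * rx(1) A(5) B(5) by (intro p)
    then show "?p (r \<odot>\<^bsub>M\<lparr>carrier := S\<rparr>\<^esub> x) = r \<odot>\<^bsub>M\<lparr>carrier := A\<rparr>\<^esub> ?p x"
      unfolding *(3) p[OF *(1,2)] by simp
  qed auto
qed

text \<open>Zorn's lemma: the union of a chain of submodules is a submodule, and meeting
  \<open>B\<close> only in zero is inherited by unions. Nothing but the elements of \<open>B\<close>
  matters here, so it may be any set.\<close>

lemma submodule_maximal_disjoint:
  assumes "right_module R M" "submodule A R M" "A \<inter> B = {\<zero>\<^bsub>M\<^esub>}"
  obtains C where "submodule C R M" "A \<subseteq> C" "C \<inter> B = {\<zero>\<^bsub>M\<^esub>}"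
    "\<And>D. \<lbrakk>submodule D R M; C \<subseteq> D; D \<inter> B = {\<zero>\<^bsub>M\<^esub>}\<rbrakk> \<Longrightarrow> D = C"
proof -
  let ?X = "{C. submodule C R M \<and> A \<subseteq> C \<and> C \<inter> B = {\<zero>\<^bsub>M\<^esub>}}"
  have "\<exists>C\<in>?X. \<forall>D\<in>?X. C \<subseteq> D \<longrightarrow> D = C"
  proof (rule subset_Zorn_nonempty)
    fix \<C> assume ne: "\<C> \<noteq> {}" and ch: "subset.chain ?X \<C>"
    then have X: "\<C> \<subseteq> ?X" by (simp add: subset.chain_def)
    have "submodule (\<Union>\<C>) R M"
    proof (rule right_submoduleI[OF assms(1)])
      fix x y assume "x \<in> \<Union>\<C>" "y \<in> \<Union>\<C>"
      then obtain C1 C2 where C: "C1 \<in> \<C>" "x \<in> C1" "C2 \<in> \<C>" "y \<in> C2" by auto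
      have "C1 \<subseteq> C2 \<or> C2 \<subseteq> C1" using ch C(1,3) by (simp add: subset_chain_def)
      then obtain C where "C \<in> \<C>" "x \<in> C" "y \<in> C" using C by blast
      moreover have "submodule C R M" using X \<open>C \<in> \<C>\<close> by auto
      ultimately show "x \<oplus>\<^bsub>M\<^esub> y \<in> \<Union>\<C>" using submoduleD(3)[of C R M x y] by auto
    next
      have C: "C \<subseteq> carrier M \<and> \<zero>\<^bsub>M\<^esub> \<in> C \<and> (\<forall>r\<in>carrier R. \<forall>x\<in>C. r \<odot>\<^bsub>M\<^esub> x \<in> C)" if "C \<in> \<C>" for C
      proof -
        have "submodule C R M" using X that by auto
        from submoduleD[OF this] show ?thesis by blast
      qed
      show "\<Union>\<C> \<subseteq> carrier M" using C by blast
      show "\<zero>\<^bsub>M\<^esub> \<in> \<Union>\<C>" using C ne by blast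
      show "a \<odot>\<^bsub>M\<^esub> x \<in> \<Union>\<C>" if "a \<in> carrier R" "x \<in> \<Union>\<C>" for a x
        using C that by blast
    qed
    then show "\<Union>\<C> \<in> ?X" using X ne by auto
  qed (use assms in auto)
  then obtain C where C: "C \<in> ?X" "\<forall>D\<in>?X. C \<subseteq> D \<longrightarrow> D = C" ..
  show ?thesis
  proof (rule that)
    show "D = C" if "submodule D R M" "C \<subseteq> D" "D \<inter> B = {\<zero>\<^bsub>M\<^esub>}" for D
      using C(1) that by (intro C(2)[rule_format]) auto
  qed (use C in auto)
qed

section \<open>Indecomposable injective modules\<close>

locale indecomposable_injective =
  fixes R :: "('r, 'x) ring_scheme" and F :: "('r, 'u) module"
  assumes F_small: "F \<in> small_modules R"
    and F_indecomposable: "indecomposable R F"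
    and F_injective: "injective R F"
begin

lemma F_right_module: "right_module R F"
  using F_small by (rule right_module_small_modules)

text \<open>A substitute for having F as a direct summand that passes along monomorphisms and can be
  tested on kernels. The element type is left free so that it also applies to copowers, which are
  not carried by \<open>'u\<close>.\<close>

definition embeds :: "('r, 'v) module \<Rightarrow> bool" where
  "embeds M \<longleftrightarrow> (\<exists>\<alpha>\<in>Hom R F M. inj_on \<alpha> (carrier F))"

lemma F_nonzero: "carrier F \<noteq> {\<zero>\<^bsub>F\<^esub>}"
  using F_indecomposable by (simp add: indecomposable_def)

text \<open>Injectivity extends the identity of F along the monomorphism \<alpha>.\<close>

lemma retraction:
  fixes M :: "('r, 'u) module"
  assumes "M \<in> small_modules R" "\<alpha> \<in> Hom R F M" "inj_on \<alpha> (carrier F)"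
  obtains h where "h \<in> Hom R M F" "\<And>x. x \<in> carrier F \<Longrightarrow> h (\<alpha> x) = x"
proof -
  from F_injective[unfolded injective_def, rule_format, OF F_small assms Hom_id[OF F_right_module]]
  obtain h where h: "h \<in> Hom R M F" "compose (carrier F) h \<alpha> = (\<lambda>x\<in>carrier F. x)" ..
  show ?thesis
  proof (rule that[OF h(1)])
    show "h (\<alpha> x) = x" if "x \<in> carrier F" for x
      using fun_cong[OF h(2), of x] that by (simp add: compose_def)
  qed
qed

lemma has_summand_isomorphic_iff_embeds:
  fixes M :: "('r, 'u) module"
  assumes M: "M \<in> small_modules R"
  shows "has_summand_isomorphic R M F \<longleftrightarrow> embeds M"
proof
  assume "has_summand_isomorphic R M F"
  then obtain A B f where AB: "internal_direct_sum R M A B"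
    and f: "f \<in> Hom R (M\<lparr>carrier := A\<rparr>) F" "bij_betw f (carrier (M\<lparr>carrier := A\<rparr>)) (carrier F)"
    by (auto simp: has_summand_isomorphic_def isomorphic_def)
  have A: "submodule A R M" using AB by (simp add: internal_direct_sum_def)
  note RM = right_module_small_modules[OF M]
  obtain g where g: "g \<in> Hom R F (M\<lparr>carrier := A\<rparr>)" "bij_betw g (carrier F) (carrier (M\<lparr>carrier := A\<rparr>))"
    using Hom_inverse[OF right_module_submodule[OF RM A] F_right_module f] by metis
  have gA: "g x \<in> A" if "x \<in> carrier F" for x using Hom_closed[OF g(1) that] by simp
  have "compose (carrier F) (\<lambda>x\<in>A. x) g \<in> Hom R F M"
    by (rule Hom_compose[OF F_right_module g(1) Hom_inclusion[OF RM A]])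
  moreover have "inj_on (compose (carrier F) (\<lambda>x\<in>A. x) g) (carrier F)"
    using g(2) gA by (auto simp: bij_betw_def inj_on_def compose_def)
  ultimately show "embeds M" unfolding embeds_def by blast
next
  assume "embeds M"
  then obtain \<alpha> where \<alpha>: "\<alpha> \<in> Hom R F M" "inj_on \<alpha> (carrier F)" by (auto simp: embeds_def)
  note RM = right_module_small_modules[OF M]
  obtain h where h: "h \<in> Hom R M F" "\<And>x. x \<in> carrier F \<Longrightarrow> h (\<alpha> x) = x"
    using retraction[OF M \<alpha>] by metis
  let ?A = "\<alpha> ` carrier F"
  have ds: "internal_direct_sum R M ?A {x \<in> carrier M. h x = \<zero>\<^bsub>F\<^esub>}"
    by (rule summand_of_retraction[OF F_right_module RM \<alpha>(1) h])
  have "\<alpha> \<in> Hom R F (M\<lparr>carrier := ?A\<rparr>)" by (rule Hom_codomain[OF \<alpha>(1)]) simp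
  moreover have "bij_betw \<alpha> (carrier F) (carrier (M\<lparr>carrier := ?A\<rparr>))"
    using \<alpha>(2) by (simp add: bij_betw_def)
  ultimately obtain g where "g \<in> Hom R (M\<lparr>carrier := ?A\<rparr>) F" "bij_betw g (carrier (M\<lparr>carrier := ?A\<rparr>)) (carrier F)"
    using Hom_inverse[OF F_right_module right_module_submodule[OF RM submodule_image[OF F_right_module RM \<alpha>(1)]]]
    by metis
  then show "has_summand_isomorphic R M F"
    unfolding has_summand_isomorphic_def isomorphic_def using ds by blast
qed

text \<open>The image of a split monomorphism is a direct summand. Here it is nonzero because F is,
  so indecomposability kills its complement, the kernel of the retraction.\<close>

lemma inj_endomorphism_surj:
  assumes "\<alpha> \<in> Hom R F F" "inj_on \<alpha> (carrier F)"
  shows "\<alpha> ` carrier F = carrier F"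
proof -
  interpret F: right_module R F by (rule F_right_module)
  obtain h where h: "h \<in> Hom R F F" "\<And>x. x \<in> carrier F \<Longrightarrow> h (\<alpha> x) = x"
    using retraction[OF F_small assms] by metis
  let ?B = "{x \<in> carrier F. h x = \<zero>\<^bsub>F\<^esub>}"
  have "internal_direct_sum R F (\<alpha> ` carrier F) ?B"
    by (rule summand_of_retraction[OF F_right_module F_right_module assms(1) h])
  then have "\<alpha> ` carrier F = {\<zero>\<^bsub>F\<^esub>} \<or> ?B = {\<zero>\<^bsub>F\<^esub>}"
    using F_indecomposable by (auto simp: indecomposable_def)
  then show ?thesis
  proof
    assume "\<alpha> ` carrier F = {\<zero>\<^bsub>F\<^esub>}"
    then have \<alpha>0: "\<alpha> x = \<zero>\<^bsub>F\<^esub>" if "x \<in> carrier F" for x using that by blast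
    have "x = \<zero>\<^bsub>F\<^esub>" if "x \<in> carrier F" for x
      using h(2)[OF that] unfolding \<alpha>0[OF that] Hom_zero[OF F_right_module F_right_module h(1)] by simp
    then have "carrier F = {\<zero>\<^bsub>F\<^esub>}" using F.M.zero_closed by auto
    then show ?thesis using F_nonzero by simp
  next
    assume B: "?B = {\<zero>\<^bsub>F\<^esub>}"
    have "y = \<alpha> (h y)" if y: "y \<in> carrier F" for y
    proof -
      have ah: "\<alpha> (h y) \<in> carrier F" using y assms(1) h(1) by (simp add: Hom_closed)
      have hy: "h y \<in> carrier F" using y h(1) by (simp add: Hom_closed)
      have "y \<ominus>\<^bsub>F\<^esub> \<alpha> (h y) \<in> ?B"
        using y ah hy by (simp add: Hom_minus[OF F_right_module F_right_module h(1)] h(2) F.M.minus_eq_zero_iff)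
      then have "y \<ominus>\<^bsub>F\<^esub> \<alpha> (h y) = \<zero>\<^bsub>F\<^esub>" using B by blast
      then show ?thesis using F.M.minus_eq_zero_iff[OF y ah] by simp
    qed
    then show ?thesis using assms(1) h(1) by (force simp: Hom_closed)
  qed
qed

text \<open>
  Choose \<open>B' \<supseteq> B\<close> maximal with \<open>A \<inter> B' = 0\<close> and then \<open>A' \<supseteq> A\<close> maximal with \<open>A' \<inter> B' = 0\<close>.
  Injectivity extends the projection \<open>A' \<oplus> B' \<rightarrow> A'\<close> to an endomorphism \<open>h\<close> of \<open>F\<close>; maximality forces
  \<open>h\<close> to have kernel \<open>B'\<close> and image \<open>A'\<close>, so \<open>h\<close> is an idempotent.
\<close>

lemma uniform:
  assumes A: "submodule A R F" and B: "submodule B R F" and AB: "A \<inter> B = {\<zero>\<^bsub>F\<^esub>}"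
  shows "A = {\<zero>\<^bsub>F\<^esub>} \<or> B = {\<zero>\<^bsub>F\<^esub>}"
proof -
  note RF = F_right_module
  interpret F: right_module R F by (rule F_right_module)
  have BA: "B \<inter> A = {\<zero>\<^bsub>F\<^esub>}" using AB by (simp add: Int_commute)
  obtain B' where B': "submodule B' R F" "B \<subseteq> B'" "B' \<inter> A = {\<zero>\<^bsub>F\<^esub>}"
    and B'_max: "\<And>D. \<lbrakk>submodule D R F; B' \<subseteq> D; D \<inter> A = {\<zero>\<^bsub>F\<^esub>}\<rbrakk> \<Longrightarrow> D = B'"
    by (rule submodule_maximal_disjoint[OF RF B BA]) blast
  have AB': "A \<inter> B' = {\<zero>\<^bsub>F\<^esub>}" using B'(3) by (simp add: Int_commute)
  obtain A' where A': "submodule A' R F" "A \<subseteq> A'" "A' \<inter> B' = {\<zero>\<^bsub>F\<^esub>}"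
    and A'_max: "\<And>D. \<lbrakk>submodule D R F; A' \<subseteq> D; D \<inter> B' = {\<zero>\<^bsub>F\<^esub>}\<rbrakk> \<Longrightarrow> D = A'"
    by (rule submodule_maximal_disjoint[OF RF A AB']) blast
  have zero: "\<zero>\<^bsub>F\<^esub> \<in> A" "\<zero>\<^bsub>F\<^esub> \<in> A'" "\<zero>\<^bsub>F\<^esub> \<in> B'"
    using submoduleD(2) A A'(1) B'(1) by auto
  have sub: "A' \<subseteq> carrier F" "B' \<subseteq> carrier F"
    using submoduleD(1) A'(1) B'(1) by auto
  \<comment> \<open>\<open>B'\<close> was chosen maximal against \<open>A\<close>; since
    \<open>A \<subseteq> A'\<close> it is also maximal against the larger \<open>A'\<close>. From
    here on the pair \<open>A'\<close>, \<open>B'\<close> is symmetric.\<close>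
  have B'_eq: "D = B'" if D: "submodule D R F" "B' \<subseteq> D" "\<And>x. \<lbrakk>x \<in> D; x \<in> A'\<rbrakk> \<Longrightarrow> x = \<zero>\<^bsub>F\<^esub>" for D
  proof (rule B'_max[OF D(1,2)])
    have "\<zero>\<^bsub>F\<^esub> \<in> D" using D(1) by (rule submoduleD(2))
    then show "D \<inter> A = {\<zero>\<^bsub>F\<^esub>}" using D(3) A'(2) zero(1) by blast
  qed
  let ?S = "{a \<oplus>\<^bsub>F\<^esub> b |a b. a \<in> A' \<and> b \<in> B'}"
  obtain p where S: "submodule ?S R F" and p: "p \<in> Hom R (F\<lparr>carrier := ?S\<rparr>) (F\<lparr>carrier := A'\<rparr>)"
    "\<And>a b. \<lbrakk>a \<in> A'; b \<in> B'\<rbrakk> \<Longrightarrow> p (a \<oplus>\<^bsub>F\<^esub> b) = a"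
    by (rule submodule_sum_projection[OF RF A'(1) B'(1) A'(3)]) blast
  have pF: "p \<in> Hom R (F\<lparr>carrier := ?S\<rparr>) F"
    using p(1) sub(1) by (auto simp: Hom_def PiE_def)
  obtain h where h: "h \<in> Hom R F F" and hp: "\<And>x. x \<in> ?S \<Longrightarrow> h x = p x"
    by (rule injective_extend[OF F_injective F_small S pF]) blast
  have hsum: "h (a \<oplus>\<^bsub>F\<^esub> b) = a" if "a \<in> A'" "b \<in> B'" for a b
    using hp[of "a \<oplus>\<^bsub>F\<^esub> b"] p(2)[OF that] that by auto
  have hA: "h a = a" if "a \<in> A'" for a
    using hsum[OF that zero(3)] that sub by (simp add: subsetD)
  have hB: "h b = \<zero>\<^bsub>F\<^esub>" if "b \<in> B'" for b
    using hsum[OF zero(2) that] that sub by (simp add: subsetD)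
  \<comment> \<open>The kernel contains \<open>B'\<close> and meets \<open>A'\<close> only in zero,
    because \<open>h\<close> is the identity on \<open>A'\<close>.\<close>
  have ker: "{x \<in> carrier F. h x = \<zero>\<^bsub>F\<^esub>} = B'"
    using submodule_kernel[OF RF RF h] sub hA hB by (intro B'_eq) auto
  \<comment> \<open>The same maximality applied to a larger submodule: an \<open>x\<close> in
    \<open>A'\<close> with \<open>h x\<close> in \<open>B'\<close> satisfies \<open>h x = x\<close>,
    so it lies in both.\<close>
  have pre: "{x \<in> carrier F. h x \<in> B'} = B'"
  proof (rule B'_eq[OF submodule_vimage[OF RF RF h B'(1)]])
    show "x = \<zero>\<^bsub>F\<^esub>" if "x \<in> {x \<in> carrier F. h x \<in> B'}" "x \<in> A'" for x
      using that hA[of x] A'(3) by auto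
  qed (use sub hB zero in auto)
  \<comment> \<open>The image contains \<open>A'\<close> since \<open>h\<close> fixes it pointwise.
    If \<open>h y\<close> is in \<open>B'\<close>, then \<open>y\<close> is in \<open>B'\<close> by
    \<open>pre\<close>, so \<open>h y\<close> is zero; now maximality of \<open>A'\<close>
    applies.\<close>
  have "h ` carrier F = A'"
  proof (rule A'_max[OF submodule_image[OF RF RF h]])
    show "A' \<subseteq> h ` carrier F" using hA sub by force
    have "x \<in> {\<zero>\<^bsub>F\<^esub>}" if x: "x \<in> h ` carrier F" "x \<in> B'" for x
    proof -
      obtain y where y: "y \<in> carrier F" "x = h y" using x by auto
      then have "y \<in> B'" using pre x(2) by blast
      then show ?thesis using hB y by simp
    qed
    moreover have "\<zero>\<^bsub>F\<^esub> \<in> h ` carrier F" using hA[OF zero(2)] F.M.zero_closed by (metis imageI)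
    ultimately show "h ` carrier F \<inter> B' = {\<zero>\<^bsub>F\<^esub>}" using zero(3) by blast
  qed
  then have hA': "h x \<in> A'" if "x \<in> carrier F" for x using that by auto
  have "\<exists>a\<in>A'. \<exists>b\<in>B'. x = a \<oplus>\<^bsub>F\<^esub> b" if x: "x \<in> carrier F" for x
  proof (intro bexI)
    have hx: "h x \<in> carrier F" using Hom_closed[OF h x] .
    show "x = h x \<oplus>\<^bsub>F\<^esub> (x \<ominus>\<^bsub>F\<^esub> h x)"
      using x hx by (simp add: a_minus_def F.M.a_lcomm F.M.r_neg)
    have "h (x \<ominus>\<^bsub>F\<^esub> h x) = \<zero>\<^bsub>F\<^esub>"
      using x hx hA[OF hA'[OF x]] by (simp add: Hom_minus[OF RF RF h] F.M.minus_eq_zero_iff)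
    then show "x \<ominus>\<^bsub>F\<^esub> h x \<in> B'" using x hx ker by auto
  qed (use x hA' in auto)
  then have "internal_direct_sum R F A' B'"
    using A'(1,3) B'(1) by (auto simp: internal_direct_sum_def)
  then have "A' = {\<zero>\<^bsub>F\<^esub>} \<or> B' = {\<zero>\<^bsub>F\<^esub>}"
    using F_indecomposable by (auto simp: indecomposable_def)
  then show ?thesis
    using A'(2) B'(2) submoduleD(2)[OF A] submoduleD(2)[OF B] by auto
qed

section \<open>Maps out of F with nonzero kernel, and the maximal ideal of End(F)\<close>

lemma not_inj_HomE:
  assumes "right_module R M" "f \<in> Hom R F M" "\<not> inj_on f (carrier F)"
  obtains x where "x \<in> carrier F" "x \<noteq> \<zero>\<^bsub>F\<^esub>" "f x = \<zero>\<^bsub>M\<^esub>"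
  using assms inj_on_Hom_iff[OF F_right_module] by blast

lemma inj_HomD:
  assumes "right_module R M" "f \<in> Hom R F M" "inj_on f (carrier F)" "x \<in> carrier F" "f x = \<zero>\<^bsub>M\<^esub>"
  shows "x = \<zero>\<^bsub>F\<^esub>"
  using assms inj_on_Hom_iff[OF F_right_module] by blast

text \<open>The kernel of the sum contains the intersection of the two kernels, and two nonzero
  submodules of the uniform module F cannot intersect in zero.\<close>

lemma not_inj_add:
  assumes "right_module R M" "f \<in> Hom R F M" "g \<in> Hom R F M"
    and "\<not> inj_on f (carrier F)" "\<not> inj_on g (carrier F)"
  shows "\<not> inj_on (\<lambda>x\<in>carrier F. f x \<oplus>\<^bsub>M\<^esub> g x) (carrier F)"
proof
  interpret M: right_module R M by fact
  let ?A = "{x \<in> carrier F. f x = \<zero>\<^bsub>M\<^esub>}" and ?B = "{x \<in> carrier F. g x = \<zero>\<^bsub>M\<^esub>}"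
  assume inj: "inj_on (\<lambda>x\<in>carrier F. f x \<oplus>\<^bsub>M\<^esub> g x) (carrier F)"
  have "x \<in> {\<zero>\<^bsub>F\<^esub>}" if "x \<in> ?A \<inter> ?B" for x
    using that inj_HomD[OF assms(1) Hom_add_closed[OF F_right_module assms(1-3)] inj, of x] by simp
  moreover have sA: "submodule ?A R F" and sB: "submodule ?B R F"
    using submodule_kernel[OF F_right_module assms(1)] assms by auto
  ultimately have "?A \<inter> ?B = {\<zero>\<^bsub>F\<^esub>}"
    using submoduleD(2)[OF sA] submoduleD(2)[OF sB] by blast
  then have "?A = {\<zero>\<^bsub>F\<^esub>} \<or> ?B = {\<zero>\<^bsub>F\<^esub>}" by (rule uniform[OF sA sB])
  moreover obtain x where "x \<in> carrier F" "x \<noteq> \<zero>\<^bsub>F\<^esub>" "f x = \<zero>\<^bsub>M\<^esub>"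
    by (rule not_inj_HomE[OF assms(1,2,4)])
  moreover obtain y where "y \<in> carrier F" "y \<noteq> \<zero>\<^bsub>F\<^esub>" "g y = \<zero>\<^bsub>M\<^esub>"
    by (rule not_inj_HomE[OF assms(1,3,5)])
  ultimately show False by blast
qed

text \<open>The non-injective endomorphisms form a proper ideal, and \<open>I\<close> is contained
  in it: an injective member of \<open>I\<close> would have a left inverse and put the unit into
  \<open>I\<close>. Maximality of \<open>I\<close> turns the inclusion into an equality.\<close>

lemma maximalideal_End_eq:
  assumes "maximalideal I (End R F)"
  shows "I = {f \<in> Hom R F F. \<not> inj_on f (carrier F)}" (is "_ = ?N")
proof -
  interpret F: right_module R F by (rule F_right_module)
  interpret I: maximalideal I "End R F" by fact
  note RF = F_right_module
  have carr: "carrier (End R F) = Hom R F F" by (simp add: End_def)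
  obtain z where z: "z \<in> carrier F" "z \<noteq> \<zero>\<^bsub>F\<^esub>"
    using F_nonzero F.M.zero_closed by blast
  have NI: "f \<in> ?N" if "f \<in> Hom R F F" "x \<in> carrier F" "x \<noteq> \<zero>\<^bsub>F\<^esub>" "f x = \<zero>\<^bsub>F\<^esub>" for f x
    using that inj_HomD[OF RF] by blast
  have grp': "Hom_group R F F = add_monoid (End R F)"
    by (simp add: Hom_group_def End_def)
  interpret H: comm_group "Hom_group R F F" by (rule Hom_group_comm_group[OF RF RF])
  have "ideal ?N (End R F)"
  proof (rule idealI)
    show "ring (End R F)" by (rule I.ring_axioms)
    show "subgroup ?N (add_monoid (End R F))"
    proof (unfold grp'[symmetric], rule H.subgroupI)
      show "?N \<subseteq> carrier (Hom_group R F F)" by (auto simp: Hom_group_def)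
      show "?N \<noteq> {}" using NI[OF Hom_zero_closed[OF RF RF] z] z by auto
      fix f assume f: "f \<in> ?N"
      then have "f \<in> Hom R F F" "\<not> inj_on f (carrier F)" by auto
      then obtain x where x: "x \<in> carrier F" "x \<noteq> \<zero>\<^bsub>F\<^esub>" "f x = \<zero>\<^bsub>F\<^esub>"
        by (rule not_inj_HomE[OF RF])
      show "inv\<^bsub>Hom_group R F F\<^esub> f \<in> ?N"
        using NI[OF inv_Hom_group(1)[OF RF RF, of f] x(1,2)] inv_Hom_group(2)[OF RF RF, of f x] f x by simp
    next
      fix f g assume f: "f \<in> ?N" and g: "g \<in> ?N"
      then show "f \<otimes>\<^bsub>Hom_group R F F\<^esub> g \<in> ?N"
        using Hom_add_closed[OF RF RF] not_inj_add[OF RF] by (simp add: Hom_group_def)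
    qed
  next
    fix f g assume "f \<in> ?N" "g \<in> carrier (End R F)"
    then have f: "f \<in> Hom R F F" "\<not> inj_on f (carrier F)" and g: "g \<in> Hom R F F" by (auto simp: carr)
    obtain x where x: "x \<in> carrier F" "x \<noteq> \<zero>\<^bsub>F\<^esub>" "f x = \<zero>\<^bsub>F\<^esub>"
      by (rule not_inj_HomE[OF RF f])
    have "compose (carrier F) g f \<in> ?N"
      using x Hom_zero[OF RF RF g] by (intro NI[OF Hom_compose[OF RF f(1) g] x(1,2)]) (simp add: compose_eq)
    then show "g \<otimes>\<^bsub>End R F\<^esub> f \<in> ?N" by (simp add: End_def)
    have "compose (carrier F) f g \<in> ?N"
    proof (cases "inj_on g (carrier F)")
      \<comment> \<open>An injective endomorphism is onto, so the nonzero kernel element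
        \<open>x\<close> of \<open>f\<close> has a preimage, which is a nonzero kernel element of
        the composite.\<close>
      case True
      then obtain y where y: "y \<in> carrier F" "g y = x"
        using inj_endomorphism_surj[OF g] x(1) by (metis imageE)
      have "y \<noteq> \<zero>\<^bsub>F\<^esub>" using y x(2) Hom_zero[OF RF RF g] by auto
      then show ?thesis
        using x y by (intro NI[OF Hom_compose[OF RF g f(1)] y(1)]) (auto simp: compose_eq)
    next
      case False
      obtain y where y: "y \<in> carrier F" "y \<noteq> \<zero>\<^bsub>F\<^esub>" "g y = \<zero>\<^bsub>F\<^esub>"
        by (rule not_inj_HomE[OF RF g False])
      then show ?thesis
        using Hom_zero[OF RF RF f(1)] by (intro NI[OF Hom_compose[OF RF g f(1)] y(1,2)]) (simp add: compose_eq)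
    qed
    then show "f \<otimes>\<^bsub>End R F\<^esub> g \<in> ?N" by (simp add: End_def)
  qed
  moreover have "I \<subseteq> ?N"
  proof
    fix f assume f: "f \<in> I"
    have fH: "f \<in> Hom R F F" using I.a_subset f carr by auto
    moreover have "\<not> inj_on f (carrier F)"
    proof
      assume "inj_on f (carrier F)"
      from retraction[OF F_small fH this]
      obtain h where h: "h \<in> Hom R F F" "\<And>x. x \<in> carrier F \<Longrightarrow> h (f x) = x" by blast
      have "h \<otimes>\<^bsub>End R F\<^esub> f = \<one>\<^bsub>End R F\<^esub>"
        using h(2) by (auto simp: End_def compose_def intro!: restrict_ext)
      then have "\<one>\<^bsub>End R F\<^esub> \<in> I" using I.I_l_closed[OF f, of h] h(1) carr by simp
      then show False using I.one_imp_carrier I.I_notcarr by simp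
    qed
    ultimately show "f \<in> ?N" by simp
  qed
  moreover have "?N \<subseteq> carrier (End R F)" by (auto simp: carr)
  ultimately have "?N = I \<or> ?N = carrier (End R F)" by (rule I.I_maximal)
  moreover have "?N \<noteq> carrier (End R F)"
  proof -
    have "(\<lambda>x\<in>carrier F. x) \<in> Hom R F F" "inj_on (\<lambda>x\<in>carrier F. x) (carrier F)"
      using Hom_id[OF RF] by (auto simp: inj_on_def)
    then show ?thesis unfolding carr by blast
  qed
  ultimately show ?thesis by simp
qed

end

section \<open>Copowers\<close>

definition copower_proj :: "'k set \<Rightarrow> ('r, 'a) module \<Rightarrow> 'k \<Rightarrow> ('k \<Rightarrow> 'a) \<Rightarrow> 'a" where
  "copower_proj K M k = (\<lambda>f\<in>carrier (copower K M). f k)"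

definition copower_inj :: "'k set \<Rightarrow> ('r, 'a) module \<Rightarrow> 'k \<Rightarrow> 'a \<Rightarrow> 'k \<Rightarrow> 'a" where
  "copower_inj K M k = (\<lambda>x\<in>carrier M. \<lambda>j\<in>K. if j = k then x else \<zero>\<^bsub>M\<^esub>)"

lemma copower_carrierI:
  assumes "\<And>k. k \<in> K \<Longrightarrow> f k \<in> carrier M" "finite {k \<in> K. f k \<noteq> \<zero>\<^bsub>M\<^esub>}"
  shows "restrict f K \<in> carrier (copower K M)"
proof -
  have "{k \<in> K. restrict f K k \<noteq> \<zero>\<^bsub>M\<^esub>} = {k \<in> K. f k \<noteq> \<zero>\<^bsub>M\<^esub>}" by auto
  then show ?thesis using assms by (simp add: copower_def)
qed

lemma copower_carrierD:
  assumes "f \<in> carrier (copower K M)"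
  shows "k \<in> K \<Longrightarrow> f k \<in> carrier M" "finite {k \<in> K. f k \<noteq> \<zero>\<^bsub>M\<^esub>}" "f \<in> extensional K"
  using assms by (auto simp: copower_def PiE_def)

lemma copower_eqI:
  assumes "f \<in> carrier (copower K M)" "g \<in> carrier (copower K M)" "\<And>k. k \<in> K \<Longrightarrow> f k = g k"
  shows "f = g"
  using copower_carrierD(3)[OF assms(1)] copower_carrierD(3)[OF assms(2)] assms(3) by (rule extensionalityI)

lemma copower_ops:
  "f \<oplus>\<^bsub>copower K M\<^esub> g = (\<lambda>k\<in>K. f k \<oplus>\<^bsub>M\<^esub> g k)" "\<zero>\<^bsub>copower K M\<^esub> = (\<lambda>k\<in>K. \<zero>\<^bsub>M\<^esub>)"
  "a \<odot>\<^bsub>copower K M\<^esub> f = (\<lambda>k\<in>K. a \<odot>\<^bsub>M\<^esub> f k)"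
  by (simp_all add: copower_def)

lemma copower_closed:
  assumes "right_module R M"
  shows "\<lbrakk>f \<in> carrier (copower K M); g \<in> carrier (copower K M)\<rbrakk> \<Longrightarrow> (\<lambda>k\<in>K. f k \<oplus>\<^bsub>M\<^esub> g k) \<in> carrier (copower K M)"
    and "f \<in> carrier (copower K M) \<Longrightarrow> (\<lambda>k\<in>K. \<ominus>\<^bsub>M\<^esub> f k) \<in> carrier (copower K M)"
    and "(\<lambda>k\<in>K. \<zero>\<^bsub>M\<^esub>) \<in> carrier (copower K M)"
    and "\<lbrakk>a \<in> carrier R; f \<in> carrier (copower K M)\<rbrakk> \<Longrightarrow> (\<lambda>k\<in>K. a \<odot>\<^bsub>M\<^esub> f k) \<in> carrier (copower K M)"
proof -
  interpret right_module R M by fact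
  show "(\<lambda>k\<in>K. f k \<oplus>\<^bsub>M\<^esub> g k) \<in> carrier (copower K M)"
    if f: "f \<in> carrier (copower K M)" and g: "g \<in> carrier (copower K M)"
  proof (rule copower_carrierI)
    show "finite {k \<in> K. f k \<oplus>\<^bsub>M\<^esub> g k \<noteq> \<zero>\<^bsub>M\<^esub>}"
      by (rule finite_subset[OF _ finite_UnI[OF copower_carrierD(2)[OF f] copower_carrierD(2)[OF g]]]) auto
  qed (use copower_carrierD(1)[OF f] copower_carrierD(1)[OF g] in auto)
  show "(\<lambda>k\<in>K. \<ominus>\<^bsub>M\<^esub> f k) \<in> carrier (copower K M)" if f: "f \<in> carrier (copower K M)"
  proof (rule copower_carrierI)
    show "finite {k \<in> K. \<ominus>\<^bsub>M\<^esub> f k \<noteq> \<zero>\<^bsub>M\<^esub>}"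
      by (rule finite_subset[OF _ copower_carrierD(2)[OF f]]) auto
  qed (use copower_carrierD(1)[OF f] in auto)
  show "(\<lambda>k\<in>K. \<zero>\<^bsub>M\<^esub>) \<in> carrier (copower K M)"
    by (rule copower_carrierI) auto
  show "(\<lambda>k\<in>K. a \<odot>\<^bsub>M\<^esub> f k) \<in> carrier (copower K M)"
    if a: "a \<in> carrier R" and f: "f \<in> carrier (copower K M)"
  proof (rule copower_carrierI)
    show "finite {k \<in> K. a \<odot>\<^bsub>M\<^esub> f k \<noteq> \<zero>\<^bsub>M\<^esub>}"
      by (rule finite_subset[OF _ copower_carrierD(2)[OF f]]) (use a in \<open>auto simp: smult_r_null\<close>)
  qed (use copower_carrierD(1)[OF f] a in \<open>auto simp: smult_closed\<close>)
qed

lemma right_module_copower: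
  assumes "right_module R M"
  shows "right_module R (copower K M)"
proof -
  interpret right_module R M by fact
  note cl = copower_closed[OF assms]
  note D = copower_carrierD(1)
  have "abelian_group (copower K M)"
  proof (rule abelian_groupI; unfold copower_ops)
    fix f g assume f: "f \<in> carrier (copower K M)" and g: "g \<in> carrier (copower K M)"
    show "(\<lambda>k\<in>K. f k \<oplus>\<^bsub>M\<^esub> g k) = (\<lambda>k\<in>K. g k \<oplus>\<^bsub>M\<^esub> f k)"
      using D[OF f] D[OF g] by (auto simp: M.a_comm intro!: restrict_ext)
    fix h assume h: "h \<in> carrier (copower K M)"
    show "(\<lambda>k\<in>K. (\<lambda>k\<in>K. f k \<oplus>\<^bsub>M\<^esub> g k) k \<oplus>\<^bsub>M\<^esub> h k) = (\<lambda>k\<in>K. f k \<oplus>\<^bsub>M\<^esub> (\<lambda>k\<in>K. g k \<oplus>\<^bsub>M\<^esub> h k) k)"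
      using D[OF f] D[OF g] D[OF h] by (auto simp: M.a_assoc intro!: restrict_ext)
  next
    fix f assume f: "f \<in> carrier (copower K M)"
    show "(\<lambda>k\<in>K. (\<lambda>k\<in>K. \<zero>\<^bsub>M\<^esub>) k \<oplus>\<^bsub>M\<^esub> f k) = f"
      using D[OF f] by (intro copower_eqI[OF cl(1)[OF cl(3) f] f]) simp
    show "\<exists>g\<in>carrier (copower K M). (\<lambda>k\<in>K. g k \<oplus>\<^bsub>M\<^esub> f k) = (\<lambda>k\<in>K. \<zero>\<^bsub>M\<^esub>)"
      using D[OF f] by (intro bexI[OF _ cl(2)[OF f]]) (auto simp: M.l_neg intro!: restrict_ext)
  qed (intro cl; assumption)+
  moreover have "right_module_axioms R (copower K M)"
  proof (rule right_module_axioms.intro; unfold copower_ops)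
    fix f assume f: "f \<in> carrier (copower K M)"
    show "(\<lambda>k\<in>K. \<one>\<^bsub>R\<^esub> \<odot>\<^bsub>M\<^esub> f k) = f"
      using D[OF f] by (intro copower_eqI[OF cl(4)[OF R.one_closed f] f]) (simp add: smult_one)
    fix a assume a: "a \<in> carrier R"
    show "(\<lambda>k\<in>K. a \<odot>\<^bsub>M\<^esub> f k) \<in> carrier (copower K M)" by (rule cl(4)[OF a f])
    show "(\<lambda>k\<in>K. (a \<oplus>\<^bsub>R\<^esub> b) \<odot>\<^bsub>M\<^esub> f k) = (\<lambda>k\<in>K. (\<lambda>k\<in>K. a \<odot>\<^bsub>M\<^esub> f k) k \<oplus>\<^bsub>M\<^esub> (\<lambda>k\<in>K. b \<odot>\<^bsub>M\<^esub> f k) k)"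
      "(\<lambda>k\<in>K. (a \<otimes>\<^bsub>R\<^esub> b) \<odot>\<^bsub>M\<^esub> f k) = (\<lambda>k\<in>K. b \<odot>\<^bsub>M\<^esub> (\<lambda>k\<in>K. a \<odot>\<^bsub>M\<^esub> f k) k)"
      if b: "b \<in> carrier R" for b
      using D[OF f] a b by (auto simp: smult_l_distr smult_assoc intro!: restrict_ext)
    fix g assume g: "g \<in> carrier (copower K M)"
    show "(\<lambda>k\<in>K. a \<odot>\<^bsub>M\<^esub> (\<lambda>k\<in>K. f k \<oplus>\<^bsub>M\<^esub> g k) k) = (\<lambda>k\<in>K. (\<lambda>k\<in>K. a \<odot>\<^bsub>M\<^esub> f k) k \<oplus>\<^bsub>M\<^esub> (\<lambda>k\<in>K. a \<odot>\<^bsub>M\<^esub> g k) k)"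
      using D[OF f] D[OF g] a by (auto simp: smult_r_distr intro!: restrict_ext)
  qed
  ultimately show ?thesis by (intro right_module.intro) (rule R.ring_axioms)
qed

lemma copower_proj_Hom:
  assumes "right_module R M" "k \<in> K"
  shows "copower_proj K M k \<in> Hom R (copower K M) M"
  unfolding copower_proj_def
  by (rule restrict_HomI[OF right_module_copower[OF assms(1)]])
    (use assms(2) copower_carrierD(1) in \<open>auto simp: copower_ops\<close>)

lemma copower_inj_Hom:
  assumes "right_module R M" "k \<in> K"
  shows "copower_inj K M k \<in> Hom R M (copower K M)"
proof -
  interpret right_module R M by fact
  show ?thesis
    unfolding copower_inj_def
  proof (rule restrict_HomI[OF assms(1)])
    fix x assume x: "x \<in> carrier M"
    show "(\<lambda>j\<in>K. if j = k then x else \<zero>\<^bsub>M\<^esub>) \<in> carrier (copower K M)"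
    proof (rule copower_carrierI)
      show "finite {j \<in> K. (if j = k then x else \<zero>\<^bsub>M\<^esub>) \<noteq> \<zero>\<^bsub>M\<^esub>}"
        by (rule finite_subset[of _ "{k}"]) auto
    qed (use x in auto)
  qed (auto simp: copower_ops smult_r_null intro!: restrict_ext)
qed


section \<open>Ideals of categories of modules\<close>

locale module_cat_ideal =
  fixes R :: "('r, 'x) ring_scheme" and \<C> :: "('r, 'u) module set" and J :: "('r, 'u) hom_family"
  assumes objects: "\<C> \<subseteq> small_modules R" and ideal: "cat_ideal R \<C> J"
begin

lemma right_module_object: "A \<in> \<C> \<Longrightarrow> right_module R A"
  using objects right_module_small_modules by blast

lemma subgroup_J: "\<lbrakk>A \<in> \<C>; B \<in> \<C>\<rbrakk> \<Longrightarrow> subgroup (J A B) (Hom_group R A B)"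
  using ideal by (simp add: cat_ideal_def)

lemma J_Hom: "\<lbrakk>A \<in> \<C>; B \<in> \<C>; f \<in> J A B\<rbrakk> \<Longrightarrow> f \<in> Hom R A B"
  using subgroup.subset[OF subgroup_J, of A B] by (auto simp: Hom_group_def)

lemma J_add:
  "\<lbrakk>A \<in> \<C>; B \<in> \<C>; f \<in> J A B; g \<in> J A B\<rbrakk> \<Longrightarrow> (\<lambda>x\<in>carrier A. f x \<oplus>\<^bsub>B\<^esub> g x) \<in> J A B"
  using subgroup.m_closed[OF subgroup_J, of A B f g] by (simp add: Hom_group_def)

lemma J_zero: "\<lbrakk>A \<in> \<C>; B \<in> \<C>\<rbrakk> \<Longrightarrow> (\<lambda>x\<in>carrier A. \<zero>\<^bsub>B\<^esub>) \<in> J A B"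
  using subgroup.one_closed[OF subgroup_J, of A B] by (simp add: Hom_group_def)

lemma J_inv: "\<lbrakk>A \<in> \<C>; B \<in> \<C>; f \<in> J A B\<rbrakk> \<Longrightarrow> inv\<^bsub>Hom_group R A B\<^esub> f \<in> J A B"
  using subgroup.m_inv_closed[OF subgroup_J, of A B f] by simp

lemma J_comp:
  assumes "X \<in> \<C>" "A \<in> \<C>" "B \<in> \<C>" "Y \<in> \<C>" "f \<in> Hom R X A" "i \<in> J A B" "g \<in> Hom R B Y"
  shows "(\<lambda>x\<in>carrier X. g (i (f x))) \<in> J X Y"
proof -
  have "compose (carrier X) g (compose (carrier X) i f) \<in> J X Y"
    using ideal assms unfolding cat_ideal_def by blast
  moreover have "compose (carrier X) g (compose (carrier X) i f) = (\<lambda>x\<in>carrier X. g (i (f x)))"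
    by (auto simp: compose_def intro!: restrict_ext)
  ultimately show ?thesis by simp
qed

text \<open>An object whose identity lies in \<open>J\<close> is zero modulo \<open>J\<close>, and
  so is every map factoring through it.\<close>

lemma J_factor:
  assumes "X \<in> \<C>" "A \<in> \<C>" "Y \<in> \<C>" "(\<lambda>x\<in>carrier A. x) \<in> J A A" "f \<in> Hom R X A" "g \<in> Hom R A Y"
  shows "(\<lambda>x\<in>carrier X. g (f x)) \<in> J X Y"
proof -
  have "(\<lambda>x\<in>carrier X. g ((\<lambda>x\<in>carrier A. x) (f x))) \<in> J X Y"
    by (rule J_comp[OF assms(1,2,2,3,5,4,6)])
  moreover have "(\<lambda>x\<in>carrier X. g ((\<lambda>x\<in>carrier A. x) (f x))) = (\<lambda>x\<in>carrier X. g (f x))"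
    using Hom_closed[OF assms(5)] by (auto intro!: restrict_ext)
  ultimately show ?thesis by simp
qed

text \<open>Every morphism factors through the identity of its domain. Hence a proper ideal misses
  the identity of some object, which is how properness is exploited below.\<close>

lemma eq_Hom_if_identities:
  assumes "\<And>A. A \<in> \<C> \<Longrightarrow> (\<lambda>x\<in>carrier A. x) \<in> J A A"
  shows "cat_ideal_eq \<C> J (Hom R)"
proof -
  have "f \<in> J A B" if AB: "A \<in> \<C>" "B \<in> \<C>" and f: "f \<in> Hom R A B" for A B f
  proof -
    have "(\<lambda>x\<in>carrier A. f ((\<lambda>x\<in>carrier A. x) x)) \<in> J A B"
      by (rule J_factor[OF AB(1,1,2) assms[OF AB(1)] Hom_id[OF right_module_object[OF AB(1)]] f])
    moreover have "(\<lambda>x\<in>carrier A. f ((\<lambda>x\<in>carrier A. x) x)) = f"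
      by (rule Hom_eqI[OF _ f]) (use calculation AB J_Hom in auto)
    ultimately show ?thesis by simp
  qed
  then show ?thesis using J_Hom by (auto simp: cat_ideal_eq_def)
qed

end


section \<open>Objects of rank zero and one, and reduction to rank zero\<close>

context indecomposable_injective
begin

abbreviation "C\<^sub>F \<equiv> finite_rank_modules R F"

lemma finite_rank_small: "C\<^sub>F \<subseteq> small_modules R"
  by (auto simp: finite_rank_modules_def)

lemma not_embeds_finite_rank:
  assumes M: "M \<in> small_modules R" "\<not> embeds M"
  shows "M \<in> C\<^sub>F"
proof -
  interpret right_module R M using M by (intro right_module_small_modules)
  let ?Z = "M\<lparr>carrier := {\<zero>\<^bsub>M\<^esub>}\<rparr>"
  have "internal_direct_sum R M {\<zero>\<^bsub>M\<^esub>} (carrier M)"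
    using submodule_singleton_zero submodule_carrier right_module_axioms
    by (auto simp: internal_direct_sum_def)
  moreover have "isomorphic R ?Z (copower {..<0::nat} F)"
    unfolding isomorphic_def
  proof (intro bexI)
    \<comment> \<open>Over the empty index set there is exactly one extensional function, so the
      copower is a zero module and matches the zero summand.\<close>
    let ?f = "\<lambda>x\<in>carrier ?Z. \<lambda>k\<in>{..<0::nat}. \<zero>\<^bsub>F\<^esub>"
    have C: "carrier (copower {..<0::nat} F) = {\<lambda>k\<in>{..<0}. \<zero>\<^bsub>F\<^esub>}"
      by (auto simp: copower_def)
    show "?f \<in> Hom R ?Z (copower {..<0} F)"
      by (rule HomI) (auto simp: C[simplified] copower_ops smult_r_null)
    show "bij_betw ?f (carrier ?Z) (carrier (copower {..<0} F))"
      unfolding C by (simp add: bij_betw_def)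
  qed
  moreover have "\<not> has_summand_isomorphic R (M\<lparr>carrier := carrier M\<rparr>) F"
    using M has_summand_isomorphic_iff_embeds by simp
  ultimately have "has_rank R F M {..<0::nat}" unfolding has_rank_def by blast
  then show ?thesis using M(1) unfolding finite_rank_modules_def by blast
qed

text \<open>F has rank 1, with zero complement. This makes F an object of the category, so that an
  ideal can be asked whether it contains 1_F.\<close>

lemma F_finite_rank: "F \<in> C\<^sub>F"
proof -
  interpret right_module R F by (rule F_right_module)
  have "internal_direct_sum R F (carrier F) {\<zero>\<^bsub>F\<^esub>}"
    using submodule_singleton_zero submodule_carrier right_module_axioms
    by (auto simp: internal_direct_sum_def)
  moreover have "isomorphic R (F\<lparr>carrier := carrier F\<rparr>) (copower {..<1::nat} F)"
    unfolding isomorphic_def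
  proof (intro bexI)
    have one: "{..<1::nat} = {0}" by auto
    let ?f = "copower_inj {..<1::nat} F 0"
    show "?f \<in> Hom R (F\<lparr>carrier := carrier F\<rparr>) (copower {..<1} F)"
      using copower_inj_Hom[OF F_right_module, of "0::nat" "{..<1}"] by simp
    then have cl: "?f x \<in> carrier (copower {..<1} F)" if "x \<in> carrier F" for x
      using Hom_closed that by force
    have "bij_betw ?f (carrier F) (carrier (copower {..<1} F))"
    proof (rule bij_betw_byWitness[where f'="\<lambda>f. f 0"])
      show "\<forall>f\<in>carrier (copower {..<1::nat} F). ?f (f 0) = f"
      proof
        fix f assume f: "f \<in> carrier (copower {..<1::nat} F)"
        then have f0: "f 0 \<in> carrier F" by (rule copower_carrierD(1)) simp
        show "?f (f 0) = f"
          by (rule copower_eqI[OF cl[OF f0] f]) (use f0 in \<open>simp add: copower_inj_def\<close>)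
      qed
      show "(\<lambda>f. f 0) ` carrier (copower {..<1::nat} F) \<subseteq> carrier F"
        using copower_carrierD(1) by fastforce
    qed (use cl in \<open>auto simp: copower_inj_def\<close>)
    then show "bij_betw ?f (carrier (F\<lparr>carrier := carrier F\<rparr>)) (carrier (copower {..<1} F))" by simp
  qed
  moreover have "\<not> has_summand_isomorphic R (F\<lparr>carrier := {\<zero>\<^bsub>F\<^esub>}\<rparr>) F"
  proof -
    let ?Z = "F\<lparr>carrier := {\<zero>\<^bsub>F\<^esub>}\<rparr>"
    have s: "?Z \<in> small_modules R"
      by (rule small_modules_submodule[OF F_small submodule_singleton_zero[OF F_right_module]])
    have "\<not> embeds ?Z"
    proof
      assume "embeds ?Z"
      then obtain \<alpha> where \<alpha>: "\<alpha> \<in> Hom R F ?Z" "inj_on \<alpha> (carrier F)" by (auto simp: embeds_def)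
      have "x \<in> {\<zero>\<^bsub>F\<^esub>}" if x: "x \<in> carrier F" for x
        using inj_HomD[OF right_module_small_modules[OF s] \<alpha> x] Hom_closed[OF \<alpha>(1) x] by simp
      then show False using F_nonzero M.zero_closed by blast
    qed
    then show ?thesis using has_summand_isomorphic_iff_embeds[OF s] by simp
  qed
  ultimately have "has_rank R F F {..<1::nat}" unfolding has_rank_def by blast
  then show ?thesis using F_small unfolding finite_rank_modules_def by blast
qed

text \<open>
  Modulo \<open>J\<close>, an object \<open>X = F\<^sup>n \<oplus> M\<close> is isomorphic to \<open>M\<close> as soon as \<open>J\<close> contains the identity of \<open>F\<close>.
\<close>

lemma reduce_to_rank_zero:
  assumes J: "cat_ideal R C\<^sub>F J" and FJ: "(\<lambda>x\<in>carrier F. x) \<in> J F F" and X: "X \<in> C\<^sub>F"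
  obtains M where "M \<in> small_modules R" "\<not> embeds M"
    "(\<lambda>x\<in>carrier M. x) \<in> J M M \<longrightarrow> (\<lambda>x\<in>carrier X. x) \<in> J X X"
proof -
  interpret J: module_cat_ideal R "C\<^sub>F" J using J finite_rank_small by unfold_locales
  note RF = F_right_module
  have RX: "right_module R X" by (rule J.right_module_object[OF X])
  interpret X: right_module R X by fact
  interpret F: right_module R F by (rule RF)
  have Xs: "X \<in> small_modules R" using X finite_rank_small by auto
  obtain n :: nat and A B where AB: "internal_direct_sum R X A B"
    and iso: "isomorphic R (X\<lparr>carrier := A\<rparr>) (copower {..<n} F)"
    and noF: "\<not> has_summand_isomorphic R (X\<lparr>carrier := B\<rparr>) F"
    using X by (auto simp: finite_rank_modules_def has_rank_def)
  let ?A = "X\<lparr>carrier := A\<rparr>" and ?B = "X\<lparr>carrier := B\<rparr>" and ?P = "copower {..<n} F"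
  have A: "submodule A R X" and B: "submodule B R X" and ABz: "A \<inter> B = {\<zero>\<^bsub>X\<^esub>}"
    and dec: "\<And>x. x \<in> carrier X \<Longrightarrow> \<exists>a\<in>A. \<exists>b\<in>B. x = a \<oplus>\<^bsub>X\<^esub> b"
    using AB by (auto simp: internal_direct_sum_def)
  have BAz: "B \<inter> A = {\<zero>\<^bsub>X\<^esub>}" using ABz by (simp add: Int_commute)
  have subA: "A \<subseteq> carrier X" and subB: "B \<subseteq> carrier X" using submoduleD(1) A B by auto
  have RA: "right_module R ?A" by (rule right_module_submodule[OF RX A])
  have Bs: "?B \<in> small_modules R" by (rule small_modules_submodule[OF Xs B])
  have B_emb: "\<not> embeds ?B" using noF has_summand_isomorphic_iff_embeds[OF Bs] by simp
  have BC: "?B \<in> C\<^sub>F" by (rule not_embeds_finite_rank[OF Bs B_emb])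
  have "{a \<oplus>\<^bsub>X\<^esub> b |a b. a \<in> A \<and> b \<in> B} = carrier X"
    using subA subB dec by (auto dest!: dec)
  then obtain p where p: "p \<in> Hom R X ?A" "\<And>a b. \<lbrakk>a \<in> A; b \<in> B\<rbrakk> \<Longrightarrow> p (a \<oplus>\<^bsub>X\<^esub> b) = a"
    using submodule_sum_projection[OF RX A B ABz] by (metis carrier_update_carrier)
  \<comment> \<open>\<open>submodule_sum_projection\<close> yields the first component only; for the
    projection onto \<open>B\<close> it is applied to the summands in reversed order.\<close>
  have "{b \<oplus>\<^bsub>X\<^esub> a |b a. b \<in> B \<and> a \<in> A} = carrier X"
  proof
    show "carrier X \<subseteq> {b \<oplus>\<^bsub>X\<^esub> a |b a. b \<in> B \<and> a \<in> A}"
    proof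
      fix x assume "x \<in> carrier X"
      then obtain a b where "a \<in> A" "b \<in> B" "x = a \<oplus>\<^bsub>X\<^esub> b" using dec by blast
      moreover from this have "x = b \<oplus>\<^bsub>X\<^esub> a" using subA subB X.M.a_comm[of a b] by auto
      ultimately show "x \<in> {b \<oplus>\<^bsub>X\<^esub> a |b a. b \<in> B \<and> a \<in> A}" by blast
    qed
  qed (use subA subB in auto)
  then obtain q where q: "q \<in> Hom R X ?B" "\<And>a b. \<lbrakk>b \<in> B; a \<in> A\<rbrakk> \<Longrightarrow> q (b \<oplus>\<^bsub>X\<^esub> a) = b"
    using submodule_sum_projection[OF RX B A BAz] by (metis carrier_update_carrier)
  have pq: "p x \<oplus>\<^bsub>X\<^esub> q x = x" if x: "x \<in> carrier X" for x
  proof -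
    obtain a b where ab: "a \<in> A" "b \<in> B" "x = a \<oplus>\<^bsub>X\<^esub> b" using dec[OF x] by blast
    then have "x = b \<oplus>\<^bsub>X\<^esub> a" using subA subB X.M.a_comm[of a b] by auto
    then have "q x = b" using q(2) ab by simp
    moreover have "p x = a" using p(2) ab by simp
    ultimately show ?thesis using ab by simp
  qed
  obtain \<phi> where \<phi>: "\<phi> \<in> Hom R ?A ?P" "bij_betw \<phi> (carrier ?A) (carrier ?P)"
    using iso by (auto simp: isomorphic_def)
  obtain \<psi> where \<psi>: "\<psi> \<in> Hom R ?P ?A" "\<And>x. x \<in> carrier ?A \<Longrightarrow> \<psi> (\<phi> x) = x"
    by (rule Hom_inverse[OF RA right_module_copower[OF RF] \<phi>]) blast
  have px: "\<phi> (p x) \<in> carrier ?P" if "x \<in> carrier X" for x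
    using Hom_closed[OF \<phi>(1)] Hom_closed[OF p(1) that] by simp
  \<comment> \<open>Truncation to the coordinates below \<open>m\<close>. Conjugated by the
    isomorphism, it becomes the projection \<open>?e m\<close> of \<open>X\<close> onto the first
    \<open>m\<close> copies of F, and \<open>?e n\<close> is the projection onto \<open>A\<close>.
    The induction on \<open>m\<close> uses that \<open>J\<close> is closed under sums of two
    maps.\<close>
  define t where "t m f = (\<lambda>k\<in>{..<n}. if k < m then f k else \<zero>\<^bsub>F\<^esub>)" for m f
  have t: "t m f \<in> carrier ?P" if "f \<in> carrier ?P" for m f
    unfolding t_def by (rule copower_carrierI) (use copower_carrierD(1)[OF that] in auto)
  let ?e = "\<lambda>m. \<lambda>x\<in>carrier X. \<psi> (t m (\<phi> (p x)))"
  have e: "m \<le> n \<Longrightarrow> ?e m \<in> J X X" for m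
  proof (induction m)
    case 0
    have "t 0 f = \<zero>\<^bsub>?P\<^esub>" for f by (simp add: t_def copower_ops)
    then have "?e 0 = (\<lambda>x\<in>carrier X. \<zero>\<^bsub>X\<^esub>)"
      using Hom_zero[OF right_module_copower[OF RF] RA \<psi>(1)] by simp
    then show ?case using J.J_zero[OF X X] by (simp only:)
  next
    case (Suc m)
    \<comment> \<open>\<open>?a\<close> reads off coordinate \<open>m\<close>, the first one that
      \<open>t m\<close> drops, and \<open>?b\<close> puts it back. Their composite factors through
      F and is the difference between \<open>?e (Suc m)\<close> and \<open>?e m\<close>.\<close>
    let ?a = "\<lambda>x\<in>carrier X. copower_proj {..<n} F m (\<phi> (p x))"
    let ?b = "compose (carrier F) \<psi> (copower_inj {..<n} F m)"
    have m: "m \<in> {..<n}" using Suc by simp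
    have "compose (carrier X) \<phi> p \<in> Hom R X ?P"
      by (rule Hom_compose[OF RX p(1) \<phi>(1)])
    from Hom_compose[OF RX this copower_proj_Hom[OF RF m]]
    have a: "?a \<in> Hom R X F"
      by (simp add: compose_def cong: restrict_cong)
    have "?b \<in> Hom R F ?A"
      by (rule Hom_compose[OF RF copower_inj_Hom[OF RF m] \<psi>(1)])
    then have b: "?b \<in> Hom R F X"
      using subA by (auto simp: Hom_def PiE_def)
    have "(\<lambda>x\<in>carrier X. ?e m x \<oplus>\<^bsub>X\<^esub> (\<lambda>x\<in>carrier X. ?b (?a x)) x) \<in> J X X"
      using Suc by (intro J.J_add[OF X X _ J.J_factor[OF X F_finite_rank X FJ a b]]) simp
    moreover have "(\<lambda>x\<in>carrier X. ?e m x \<oplus>\<^bsub>X\<^esub> (\<lambda>x\<in>carrier X. ?b (?a x)) x) = ?e (Suc m)"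
    proof (rule restrict_ext)
      fix x assume x: "x \<in> carrier X"
      let ?f = "\<phi> (p x)" and ?g = "copower_inj {..<n} F m (?a x)"
      have f: "?f \<in> carrier ?P" by (rule px[OF x])
      have ax: "?a x = ?f m" using f x by (simp add: copower_proj_def)
      have fm: "?f m \<in> carrier F" by (rule copower_carrierD(1)[OF f m])
      have g: "?g \<in> carrier ?P" unfolding ax by (rule Hom_closed[OF copower_inj_Hom[OF RF m] fm])
      have "t m ?f \<oplus>\<^bsub>?P\<^esub> ?g = t (Suc m) ?f"
      proof (rule copower_eqI[OF _ t[OF f]])
        show "t m ?f \<oplus>\<^bsub>?P\<^esub> ?g \<in> carrier ?P"
          using copower_closed(1)[OF RF t[OF f] g] by (simp add: copower_ops)
        show "(t m ?f \<oplus>\<^bsub>?P\<^esub> ?g) k = t (Suc m) ?f k" if k: "k \<in> {..<n}" for k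
          using k fm copower_carrierD(1)[OF f k] unfolding ax
          by (auto simp: copower_ops t_def copower_inj_def less_Suc_eq)
      qed
      then have "\<psi> (t m ?f) \<oplus>\<^bsub>X\<^esub> \<psi> ?g = \<psi> (t (Suc m) ?f)"
        using Hom_add[OF \<psi>(1) t[OF f, of m] g] x by simp
      moreover have "?b (?a x) = \<psi> ?g"
        using fm ax by (simp add: compose_def)
      ultimately show "?e m x \<oplus>\<^bsub>X\<^esub> (\<lambda>x\<in>carrier X. ?b (?a x)) x = \<psi> (t (Suc m) (\<phi> (p x)))"
        using x by simp
    qed
    ultimately show ?case by (simp only:)
  qed
  show ?thesis
  proof (rule that[OF Bs B_emb], rule impI)
    assume BJ: "(\<lambda>x\<in>carrier ?B. x) \<in> J ?B ?B"
    \<comment> \<open>The identity of \<open>X\<close> is the projection onto \<open>A\<close>,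
      already in \<open>J\<close>, plus the projection onto \<open>B\<close>, which factors through
      an object whose identity is assumed to be in \<open>J\<close>.\<close>
    have "(\<lambda>x\<in>carrier X. ?e n x \<oplus>\<^bsub>X\<^esub> (\<lambda>x\<in>carrier X. (\<lambda>x\<in>B. x) (q x)) x) \<in> J X X"
      by (rule J.J_add[OF X X e[OF order_refl] J.J_factor[OF X BC X BJ q(1) Hom_inclusion[OF RX B]]])
    moreover have "(\<lambda>x\<in>carrier X. ?e n x \<oplus>\<^bsub>X\<^esub> (\<lambda>x\<in>carrier X. (\<lambda>x\<in>B. x) (q x)) x) = (\<lambda>x\<in>carrier X. x)"
    proof (rule restrict_ext)
      fix x assume x: "x \<in> carrier X"
      have "t n (\<phi> (p x)) = \<phi> (p x)"
        by (rule copower_eqI[OF t[OF px[OF x]] px[OF x]]) (simp add: t_def)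
      then show "?e n x \<oplus>\<^bsub>X\<^esub> (\<lambda>x\<in>carrier X. (\<lambda>x\<in>B. x) (q x)) x = x"
        using x pq[OF x] \<psi>(2) Hom_closed[OF p(1) x] Hom_closed[OF q(1) x] by simp
    qed
    ultimately show "(\<lambda>x\<in>carrier X. x) \<in> J X X" by (simp only:)
  qed
qed

end

section \<open>Small copies of modules\<close>

text \<open>Objects of the category are carried by subsets of \<open>'u\<close>, whereas a copower
  is carried by functions. Its structure is moved along an injection \<open>e\<close>, with
  \<open>inv_into\<close> reading elements back.\<close>

definition transfer_module :: "('b \<Rightarrow> 'c) \<Rightarrow> ('r, 'b) module \<Rightarrow> ('r, 'c) module" where
  "transfer_module e P =
     \<lparr>carrier = e ` carrier P, monoid.mult = undefined, one = undefined, zero = e \<zero>\<^bsub>P\<^esub>,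
      add = (\<lambda>x y. e (inv_into (carrier P) e x \<oplus>\<^bsub>P\<^esub> inv_into (carrier P) e y)),
      smult = (\<lambda>a x. e (a \<odot>\<^bsub>P\<^esub> inv_into (carrier P) e x))\<rparr>"

lemma transfer_module_ops:
  assumes "inj_on e (carrier P)" "x \<in> carrier P"
  shows "y \<in> carrier P \<Longrightarrow> e x \<oplus>\<^bsub>transfer_module e P\<^esub> e y = e (x \<oplus>\<^bsub>P\<^esub> y)"
    and "a \<odot>\<^bsub>transfer_module e P\<^esub> e x = e (a \<odot>\<^bsub>P\<^esub> x)"
  using assms by (simp_all add: transfer_module_def)

lemma right_module_transfer_module:
  assumes "right_module R P" "inj_on e (carrier P)"
  shows "right_module R (transfer_module e P)"
proof -
  interpret P: right_module R P by fact
  let ?T = "transfer_module e P"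
  have car: "carrier ?T = e ` carrier P" and zero: "\<zero>\<^bsub>?T\<^esub> = e \<zero>\<^bsub>P\<^esub>"
    by (simp_all add: transfer_module_def)
  note ops = transfer_module_ops[OF assms(2)]
  have "abelian_group ?T"
  proof (rule abelian_groupI; unfold car zero)
    fix x assume "x \<in> e ` carrier P"
    then obtain x' where x': "x = e x'" "x' \<in> carrier P" by auto
    show "\<exists>y\<in>e ` carrier P. y \<oplus>\<^bsub>?T\<^esub> x = e \<zero>\<^bsub>P\<^esub>"
      using x' by (intro bexI[of _ "e (\<ominus>\<^bsub>P\<^esub> x')"]) (auto simp: ops P.M.l_neg)
  qed (auto simp: ops P.M.a_ac)
  moreover have "right_module_axioms R ?T"
    by (rule right_module_axioms.intro)
      (auto simp: car ops P.smult_closed P.smult_l_distr P.smult_r_distr P.smult_assoc P.smult_one)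
  ultimately show ?thesis by (intro right_module.intro) (rule P.R.ring_axioms)
qed

lemma small_ordLeq: "\<lbrakk>small U B; |A| \<le>o |B|\<rbrakk> \<Longrightarrow> small U A"
  unfolding small_def using ordLeq_ordLess_trans by blast

lemma isomorphic_small_module:
  fixes P :: "('r, 'b) module"
  assumes "right_module R P" "small TYPE('u) (carrier P)"
  obtains X :: "('r, 'u) module" where "X \<in> small_modules R" "isomorphic R P X"
proof -
  have "|carrier P| \<le>o |UNIV :: 'u set|"
    using assms(2) unfolding small_def by (rule ordLess_imp_ordLeq)
  then obtain e :: "'b \<Rightarrow> 'u" where e: "inj_on e (carrier P)"
    by (auto simp flip: card_of_ordLeq)
  let ?X = "transfer_module e P" and ?f = "restrict e (carrier P)"
  have car: "carrier ?X = e ` carrier P" by (simp add: transfer_module_def)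
  have "?f \<in> Hom R P ?X"
    using assms(1) by (rule restrict_HomI) (auto simp: car transfer_module_ops[OF e])
  moreover have "bij_betw ?f (carrier P) (carrier ?X)"
    using e by (simp add: car bij_betw_def)
  ultimately have "isomorphic R P ?X" unfolding isomorphic_def by blast
  moreover have "small TYPE('u) (carrier ?X)"
    unfolding car by (rule small_ordLeq[OF assms(2) card_of_image])
  then have "?X \<in> small_modules R"
    using right_module_transfer_module[OF assms(1) e] by (simp add: small_modules_def)
  ultimately show ?thesis by (rule that[rotated])
qed

text \<open>\<open>universe\<close> only speaks of subsets of \<open>'u\<close>, so a small set of
  another type is first injected into \<open>'u\<close>.\<close>

lemma small_Pow:
  fixes A :: "'a set"
  assumes "universe TYPE('u)" "small TYPE('u) A"
  shows "small TYPE('u) (Pow A)"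
proof -
  have "|A| \<le>o |UNIV :: 'u set|"
    using assms(2) unfolding small_def by (rule ordLess_imp_ordLeq)
  then obtain e :: "'a \<Rightarrow> 'u" where e: "inj_on e A"
    by (auto simp flip: card_of_ordLeq)
  have "small TYPE('u) (e ` A)" by (rule small_ordLeq[OF assms(2) card_of_image])
  then have "small TYPE('u) (Pow (e ` A))" using assms(1) by (simp add: universe_def)
  moreover have "|Pow A| \<le>o |Pow (e ` A)|"
    by (rule card_of_ordLeqI[OF inj_on_image_Pow[OF e]]) auto
  ultimately show ?thesis by (rule small_ordLeq)
qed

text \<open>An element is determined by its graph, a set of pairs. So crude a bound suffices because
  smallness survives power sets.\<close>

lemma card_copower_le: "|carrier (copower K M)| \<le>o |Pow (K \<times> carrier M)|"
proof (rule card_of_ordLeqI)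
  let ?G = "\<lambda>f. (\<lambda>k. (k, f k)) ` K"
  show "inj_on ?G (carrier (copower K M))"
  proof (rule inj_onI)
    fix f g assume fg: "f \<in> carrier (copower K M)" "g \<in> carrier (copower K M)" "?G f = ?G g"
    have "f k = g k" if "k \<in> K" for k
    proof -
      have "(k, f k) \<in> ?G g" using that fg(3) by (metis imageI)
      then show ?thesis by auto
    qed
    then show "f = g" by (rule copower_eqI[OF fg(1,2)])
  qed
  show "?G f \<in> Pow (K \<times> carrier M)" if "f \<in> carrier (copower K M)" for f
    using copower_carrierD(1)[OF that] by auto
qed

text \<open>For infinite \<open>W\<close> the product \<open>Pow W \<times> W\<close> has the
  cardinality of \<open>Pow W\<close>, hence is small; bounding the copower by sets of pairs costs
  one further power set.\<close>

lemma small_copower_Pow: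
  assumes "universe TYPE('u)" "small TYPE('u) W" "infinite W" "carrier M \<subseteq> W"
  shows "small TYPE('u) (carrier (copower (Pow W) M))"
proof -
  have "infinite (Pow W)" "W \<noteq> {}" using assms(3) by auto
  from card_of_Times_infinite[OF this ordLess_imp_ordLeq[OF card_of_Pow]]
  have "|Pow W \<times> W| \<le>o |Pow W|" by (intro ordIso_imp_ordLeq) (rule conjunct1)
  then have "small TYPE('u) (Pow W \<times> W)"
    by (rule small_ordLeq[OF small_Pow[OF assms(1,2)]])
  then have "small TYPE('u) (Pow W \<times> carrier M)"
    by (rule small_subset) (use assms(4) in auto)
  then show ?thesis
    by (rule small_ordLeq[OF small_Pow[OF assms(1)] card_copower_le])
qed


section \<open>Enlarging an ideal by morphisms with small image\<close>

lemma finite_ordLeq_infinite: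
  assumes "finite A" "infinite B"
  shows "|A| \<le>o |B|"
  using ordLeq_total[OF card_of_Well_order card_of_Well_order, of A B] card_of_ordLeq_infinite assms by blast

context module_cat_ideal
begin

text \<open>The sum of \<open>J\<close> with the maps having at most |W| values. The second summand
  is recovered as the difference f - j, so only the number of values of that difference has to be
  recorded.\<close>

definition add_small_image :: "'w set \<Rightarrow> ('r, 'u) hom_family" where
  "add_small_image W X Y =
     {f \<in> Hom R X Y. \<exists>j\<in>J X Y. |(\<lambda>x. f x \<ominus>\<^bsub>Y\<^esub> j x) ` carrier X| \<le>o |W| }"

lemma J_subset_add_small_image:
  assumes "infinite W" "A \<in> \<C>" "B \<in> \<C>"
  shows "J A B \<subseteq> add_small_image W A B"
proof
  fix f assume f: "f \<in> J A B"
  interpret B: right_module R B by (rule right_module_object[OF assms(3)])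
  have fH: "f \<in> Hom R A B" by (rule J_Hom[OF assms(2,3) f])
  have "(\<lambda>x. f x \<ominus>\<^bsub>B\<^esub> f x) ` carrier A \<subseteq> {\<zero>\<^bsub>B\<^esub>}"
    using Hom_closed[OF fH] by (auto simp: B.M.minus_eq_zero_iff)
  then have "finite ((\<lambda>x. f x \<ominus>\<^bsub>B\<^esub> f x) ` carrier A)" by (rule finite_subset) simp
  then have "|(\<lambda>x. f x \<ominus>\<^bsub>B\<^esub> f x) ` carrier A| \<le>o |W|"
    using assms(1) by (rule finite_ordLeq_infinite)
  then show "f \<in> add_small_image W A B" using f fH unfolding add_small_image_def by blast
qed

text \<open>For a sum, the values of the difference come from pairs of values of the two summands,
  and |W| times |W| is |W| because \<open>W\<close> is infinite. Composition on the left maps the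
  set of values onto the new one, and composition on the right only restricts it.\<close>

lemma cat_ideal_add_small_image:
  assumes W: "infinite W"
  shows "cat_ideal R \<C> (add_small_image W)"
proof -
  have "subgroup (add_small_image W A B) (Hom_group R A B)" if A: "A \<in> \<C>" and B: "B \<in> \<C>" for A B
  proof -
    note RA = right_module_object[OF A] and RB = right_module_object[OF B]
    interpret A: right_module R A by (rule RA)
    interpret B: right_module R B by (rule RB)
    interpret G: comm_group "Hom_group R A B" by (rule Hom_group_comm_group[OF RA RB])
    show ?thesis
    proof (rule G.subgroupI)
      show "add_small_image W A B \<subseteq> carrier (Hom_group R A B)"
        by (auto simp: add_small_image_def Hom_group_def)
      have "(\<lambda>x\<in>carrier A. \<zero>\<^bsub>B\<^esub>) \<in> add_small_image W A B"
        using J_zero[OF A B] J_subset_add_small_image[OF W A B] by blast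
      then show "add_small_image W A B \<noteq> {}" by blast
    next
      fix f assume "f \<in> add_small_image W A B"
      then obtain j where f: "f \<in> Hom R A B" and j: "j \<in> J A B"
        and c: "|(\<lambda>x. f x \<ominus>\<^bsub>B\<^esub> j x) ` carrier A| \<le>o |W|"
        by (auto simp: add_small_image_def)
      let ?f = "inv\<^bsub>Hom_group R A B\<^esub> f" and ?j = "inv\<^bsub>Hom_group R A B\<^esub> j"
      have jH: "j \<in> Hom R A B" by (rule J_Hom[OF A B j])
      have "(\<lambda>x. ?f x \<ominus>\<^bsub>B\<^esub> ?j x) ` carrier A = (\<lambda>x. \<ominus>\<^bsub>B\<^esub> (f x \<ominus>\<^bsub>B\<^esub> j x)) ` carrier A"
        using Hom_closed[OF f] Hom_closed[OF jH]
        by (intro image_cong) (simp_all add: inv_Hom_group(2)[OF RA RB] f jH a_minus_def B.M.minus_add)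
      also have "\<dots> = a_inv B ` (\<lambda>x. f x \<ominus>\<^bsub>B\<^esub> j x) ` carrier A" by (simp add: image_image)
      finally have "|(\<lambda>x. ?f x \<ominus>\<^bsub>B\<^esub> ?j x) ` carrier A| \<le>o |W|"
        using ordLeq_transitive[OF card_of_image c] by simp
      then show "?f \<in> add_small_image W A B"
        using inv_Hom_group(1)[OF RA RB f] J_inv[OF A B j] unfolding add_small_image_def by blast
    next
      fix f g assume "f \<in> add_small_image W A B" "g \<in> add_small_image W A B"
      then obtain i j where f: "f \<in> Hom R A B" and i: "i \<in> J A B"
        and ci: "|(\<lambda>x. f x \<ominus>\<^bsub>B\<^esub> i x) ` carrier A| \<le>o |W|"
        and g: "g \<in> Hom R A B" and j: "j \<in> J A B"
        and cj: "|(\<lambda>x. g x \<ominus>\<^bsub>B\<^esub> j x) ` carrier A| \<le>o |W|"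
        by (auto simp: add_small_image_def)
      have iH: "i \<in> Hom R A B" and jH: "j \<in> Hom R A B" using J_Hom[OF A B] i j by auto
      let ?f = "\<lambda>x\<in>carrier A. f x \<oplus>\<^bsub>B\<^esub> g x" and ?j = "\<lambda>x\<in>carrier A. i x \<oplus>\<^bsub>B\<^esub> j x"
      let ?S = "(\<lambda>x. f x \<ominus>\<^bsub>B\<^esub> i x) ` carrier A" and ?T = "(\<lambda>x. g x \<ominus>\<^bsub>B\<^esub> j x) ` carrier A"
      have "?f x \<ominus>\<^bsub>B\<^esub> ?j x = (f x \<ominus>\<^bsub>B\<^esub> i x) \<oplus>\<^bsub>B\<^esub> (g x \<ominus>\<^bsub>B\<^esub> j x)" if "x \<in> carrier A" for x
        using that Hom_closed[OF f that] Hom_closed[OF g that] Hom_closed[OF iH that] Hom_closed[OF jH that]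
        by (simp add: a_minus_def B.M.minus_add B.M.a_ac)
      then have "(\<lambda>x. ?f x \<ominus>\<^bsub>B\<^esub> ?j x) ` carrier A \<subseteq> (\<lambda>(s, t). s \<oplus>\<^bsub>B\<^esub> t) ` (?S \<times> ?T)"
        by (force simp: image_iff)
      then have "|(\<lambda>x. ?f x \<ominus>\<^bsub>B\<^esub> ?j x) ` carrier A| \<le>o |?S \<times> ?T|"
        by (rule surj_imp_ordLeq)
      moreover have "|?S \<times> ?T| \<le>o |W|"
        using W ci cj by (intro card_of_Times_ordLeq_infinite_Field) (simp_all add: card_of_card_order_on Field_card_of)
      ultimately have "|(\<lambda>x. ?f x \<ominus>\<^bsub>B\<^esub> ?j x) ` carrier A| \<le>o |W|" by (rule ordLeq_transitive)
      then have "?f \<in> add_small_image W A B"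
        using Hom_add_closed[OF RA RB f g] J_add[OF A B i j] unfolding add_small_image_def by blast
      then show "f \<otimes>\<^bsub>Hom_group R A B\<^esub> g \<in> add_small_image W A B" by (simp add: Hom_group_def)
    qed
  qed
  moreover have "compose (carrier X) b (compose (carrier X) f a) \<in> add_small_image W X Y"
    if X: "X \<in> \<C>" and A: "A \<in> \<C>" and B: "B \<in> \<C>" and Y: "Y \<in> \<C>"
      and a: "a \<in> Hom R X A" and f: "f \<in> add_small_image W A B" and b: "b \<in> Hom R B Y" for X A B Y a f b
  proof -
    note RX = right_module_object[OF X] and RB = right_module_object[OF B] and RY = right_module_object[OF Y]
    obtain j where fH: "f \<in> Hom R A B" and j: "j \<in> J A B"
      and c: "|(\<lambda>x. f x \<ominus>\<^bsub>B\<^esub> j x) ` carrier A| \<le>o |W|"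
      using f by (auto simp: add_small_image_def)
    have jH: "j \<in> Hom R A B" by (rule J_Hom[OF A B j])
    let ?f = "compose (carrier X) b (compose (carrier X) f a)" and ?j = "\<lambda>x\<in>carrier X. b (j (a x))"
    have "?f x \<ominus>\<^bsub>Y\<^esub> ?j x = b (f (a x) \<ominus>\<^bsub>B\<^esub> j (a x))" if "x \<in> carrier X" for x
      using that Hom_closed[OF fH] Hom_closed[OF jH] Hom_closed[OF a that]
      by (simp add: compose_def Hom_minus[OF RB RY b])
    then have "(\<lambda>x. ?f x \<ominus>\<^bsub>Y\<^esub> ?j x) ` carrier X \<subseteq> b ` (\<lambda>x. f x \<ominus>\<^bsub>B\<^esub> j x) ` carrier A"
      using Hom_closed[OF a] by (force simp: image_iff)
    then have "|(\<lambda>x. ?f x \<ominus>\<^bsub>Y\<^esub> ?j x) ` carrier X| \<le>o |W|"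
      by (rule ordLeq_transitive[OF surj_imp_ordLeq c])
    moreover have "?f \<in> Hom R X Y" by (intro Hom_compose[OF RX _ b] Hom_compose[OF RX a fH])
    ultimately show ?thesis
      using J_comp[OF X A B Y a j b] unfolding add_small_image_def by blast
  qed
  ultimately show ?thesis unfolding cat_ideal_def by blast
qed

lemma identity_in_add_small_image:
  assumes "M \<in> \<C>" "|carrier M| \<le>o |W|"
  shows "(\<lambda>x\<in>carrier M. x) \<in> add_small_image W M M"
proof -
  interpret M: right_module R M by (rule right_module_object[OF assms(1)])
  have "(\<lambda>x. (\<lambda>x\<in>carrier M. x) x \<ominus>\<^bsub>M\<^esub> (\<lambda>x\<in>carrier M. \<zero>\<^bsub>M\<^esub>) x) ` carrier M \<subseteq> carrier M"
    by auto
  then have "|(\<lambda>x. (\<lambda>x\<in>carrier M. x) x \<ominus>\<^bsub>M\<^esub> (\<lambda>x\<in>carrier M. \<zero>\<^bsub>M\<^esub>) x) ` carrier M| \<le>o |W|"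
    by (rule ordLeq_transitive[OF card_of_mono1 assms(2)])
  then show ?thesis
    using J_zero[OF assms(1,1)] Hom_id[OF right_module_object[OF assms(1)]]
    unfolding add_small_image_def by blast
qed

text \<open>
  If the identity of \<open>X\<close> were a sum \<open>j + g\<close> with \<open>j\<close> in \<open>J\<close> and \<open>|im g| \<le> |W|\<close>, then some coordinate
  \<open>k\<close> would vanish on \<open>im g\<close>, and \<open>j\<close> would restrict to the identity of the \<open>k\<close>-th copy of \<open>M\<close>.
\<close>

lemma identity_copower_notin_add_small_image:
  assumes W: "infinite W" and M: "M \<in> \<C>" and X: "X \<in> \<C>"
    and iso: "isomorphic R (copower (Pow W) M) X"
    and id_X: "(\<lambda>x\<in>carrier X. x) \<in> add_small_image W X X"
  shows "(\<lambda>x\<in>carrier M. x) \<in> J M M"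
proof -
  let ?P = "copower (Pow W) M"
  note RM = right_module_object[OF M] and RX = right_module_object[OF X]
  note RP = right_module_copower[OF RM, of "Pow W"]
  interpret X: right_module R X by (rule RX)
  interpret M: right_module R M by (rule RM)
  obtain \<theta> where \<theta>: "\<theta> \<in> Hom R ?P X" "bij_betw \<theta> (carrier ?P) (carrier X)"
    using iso by (auto simp: isomorphic_def)
  obtain \<eta> where \<eta>: "\<eta> \<in> Hom R X ?P" "\<And>p. p \<in> carrier ?P \<Longrightarrow> \<eta> (\<theta> p) = p"
    by (rule Hom_inverse[OF RP RX \<theta>]) blast
  obtain j where j: "j \<in> J X X" and c: "|(\<lambda>x. (\<lambda>x\<in>carrier X. x) x \<ominus>\<^bsub>X\<^esub> j x) ` carrier X| \<le>o |W|"
    using id_X by (auto simp: add_small_image_def)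
  have jH: "j \<in> Hom R X X" by (rule J_Hom[OF X X j])
  let ?D = "(\<lambda>x. (\<lambda>x\<in>carrier X. x) x \<ominus>\<^bsub>X\<^esub> j x) ` carrier X"
  let ?supp = "\<lambda>d. {k \<in> Pow W. \<eta> d k \<noteq> \<zero>\<^bsub>M\<^esub>}"
  have D: "d \<in> carrier X" if "d \<in> ?D" for d using that Hom_closed[OF jH] by auto
  \<comment> \<open>All coordinates touched by values of the small summand: at most |W| many
    supports, each of them finite.\<close>
  have le: "|\<Union>d\<in>?D. ?supp d| \<le>o |W|"
  proof (rule card_of_UNION_ordLeq_infinite[OF W c], rule ballI)
    fix d assume "d \<in> ?D"
    then have "finite (?supp d)" using copower_carrierD(2)[OF Hom_closed[OF \<eta>(1) D]] by simp
    then show "|?supp d| \<le>o |W|" using W by (rule finite_ordLeq_infinite)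
  qed
  \<comment> \<open>By Cantor's theorem there are more coordinates than |W|, so one of them is
    untouched. This is the reason for indexing the copower by \<open>Pow W\<close>.\<close>
  have "\<not> Pow W \<subseteq> (\<Union>d\<in>?D. ?supp d)"
    using ordLeq_transitive[OF card_of_mono1 le] not_ordLess_ordLeq[OF card_of_Pow, of W] by blast
  then obtain k where k: "k \<in> Pow W" and kD: "\<And>d. d \<in> ?D \<Longrightarrow> \<eta> d k = \<zero>\<^bsub>M\<^esub>"
    by auto
  define a where "a = compose (carrier M) \<theta> (copower_inj (Pow W) M k)"
  define b where "b = compose (carrier X) (copower_proj (Pow W) M k) \<eta>"
  have a: "a \<in> Hom R M X"
    unfolding a_def by (rule Hom_compose[OF RM copower_inj_Hom[OF RM k] \<theta>(1)])
  have b: "b \<in> Hom R X M"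
    unfolding b_def by (rule Hom_compose[OF RX \<eta>(1) copower_proj_Hom[OF RM k]])
  have b_eq: "b x = \<eta> x k" if "x \<in> carrier X" for x
    using that Hom_closed[OF \<eta>(1) that] by (simp add: b_def compose_def copower_proj_def)
  have ba: "b (a m) = m" if m: "m \<in> carrier M" for m
  proof -
    have "b (a m) = \<eta> (\<theta> (copower_inj (Pow W) M k m)) k"
      using b_eq[OF Hom_closed[OF a m]] m by (simp add: a_def compose_eq)
    also have "\<dots> = copower_inj (Pow W) M k m k"
      by (simp only: \<eta>(2)[OF Hom_closed[OF copower_inj_Hom[OF RM k] m]])
    finally show ?thesis using m k by (simp add: copower_inj_def)
  qed
  have "b (j (a m)) = m" if m: "m \<in> carrier M" for m
  proof -
    have am: "a m \<in> carrier X" by (rule Hom_closed[OF a m])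
    have jam: "j (a m) \<in> carrier X" by (rule Hom_closed[OF jH am])
    have d: "a m \<ominus>\<^bsub>X\<^esub> j (a m) \<in> ?D" using am by auto
    have "b (a m) \<ominus>\<^bsub>M\<^esub> b (j (a m)) = \<zero>\<^bsub>M\<^esub>"
      using b_eq[OF D[OF d]] kD[OF d] Hom_minus[OF RX RM b am jam] by simp
    then show ?thesis
      using M.M.minus_eq_zero_iff[OF Hom_closed[OF b am] Hom_closed[OF b jam]] ba[OF m] by simp
  qed
  then have "(\<lambda>m\<in>carrier M. b (j (a m))) = (\<lambda>m\<in>carrier M. m)" by (rule restrict_ext)
  then show ?thesis using J_comp[OF M X X M a j b] by simp
qed

end


section \<open>The associated ideal\<close>

context indecomposable_injective
begin

text \<open>
  If \<open>\<alpha>\<close> embeds \<open>F\<close> in a copower of \<open>M\<close>, take \<open>y \<noteq> 0\<close> such that \<open>\<alpha> y\<close> has minimal support and \<open>k\<close> in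
  that support.  The \<open>k\<close>-th coordinate of \<open>\<alpha>\<close> is injective on the submodule of all \<open>z\<close> such that the support
  of \<open>\<alpha> z\<close> is contained in that of \<open>\<alpha> y\<close>, hence on the uniform module \<open>F\<close>.
\<close>

lemma embeds_copower:
  assumes RM: "right_module R M" and emb: "embeds (copower K M)"
  shows "embeds M"
proof -
  note RF = F_right_module and RP = right_module_copower[OF RM, of K]
  interpret F: right_module R F by (rule RF)
  interpret M: right_module R M by (rule RM)
  obtain \<alpha> where \<alpha>: "\<alpha> \<in> Hom R F (copower K M)" "inj_on \<alpha> (carrier F)"
    using emb by (auto simp: embeds_def)
  have coord: "\<alpha> x k \<in> carrier M" if "x \<in> carrier F" "k \<in> K" for x k
    by (rule copower_carrierD(1)[OF Hom_closed[OF \<alpha>(1) that(1)] that(2)])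
  define supp where "supp x = {k \<in> K. \<alpha> x k \<noteq> \<zero>\<^bsub>M\<^esub>}" for x
  have fin: "finite (supp x)" if "x \<in> carrier F" for x
    unfolding supp_def by (rule copower_carrierD(2)[OF Hom_closed[OF \<alpha>(1) that]])
  obtain x0 where x0: "x0 \<in> carrier F \<and> x0 \<noteq> \<zero>\<^bsub>F\<^esub>"
    using F_nonzero F.M.zero_closed by blast
  obtain y where y: "y \<in> carrier F" "y \<noteq> \<zero>\<^bsub>F\<^esub>"
    and min: "\<And>z. \<lbrakk>z \<in> carrier F; z \<noteq> \<zero>\<^bsub>F\<^esub>\<rbrakk> \<Longrightarrow> card (supp y) \<le> card (supp z)"
    using ex_has_least_nat[of "\<lambda>x. x \<in> carrier F \<and> x \<noteq> \<zero>\<^bsub>F\<^esub>", OF x0, of "\<lambda>x. card (supp x)"] by blast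
  have "\<alpha> y \<noteq> \<zero>\<^bsub>copower K M\<^esub>" using inj_HomD[OF RP \<alpha> y(1)] y(2) by blast
  then have "\<exists>k\<in>K. \<alpha> y k \<noteq> \<zero>\<^bsub>M\<^esub>"
    using copower_eqI[OF Hom_closed[OF \<alpha>(1) y(1)] copower_closed(3)[OF RM]] by (auto simp: copower_ops)
  then obtain k where k: "k \<in> K" "\<alpha> y k \<noteq> \<zero>\<^bsub>M\<^esub>" by blast
  let ?f = "compose (carrier F) (copower_proj K M k) \<alpha>"
  have f: "?f \<in> Hom R F M" by (rule Hom_compose[OF RF \<alpha>(1) copower_proj_Hom[OF RM k(1)]])
  have f_eq: "?f x = \<alpha> x k" if "x \<in> carrier F" for x
    using that Hom_closed[OF \<alpha>(1) that] by (simp add: compose_def copower_proj_def)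
  let ?C = "{z \<in> carrier F. \<forall>j\<in>K. \<alpha> y j = \<zero>\<^bsub>M\<^esub> \<longrightarrow> \<alpha> z j = \<zero>\<^bsub>M\<^esub>}" and ?N = "{z \<in> carrier F. ?f z = \<zero>\<^bsub>M\<^esub>}"
  have C: "submodule ?C R F"
  proof (rule right_submoduleI[OF RF])
    show "\<zero>\<^bsub>F\<^esub> \<in> ?C"
      using Hom_zero[OF RF RP \<alpha>(1)] by (auto simp: copower_ops)
    show "a \<oplus>\<^bsub>F\<^esub> b \<in> ?C" if "a \<in> ?C" "b \<in> ?C" for a b
      using that by (auto simp: Hom_add[OF \<alpha>(1)] copower_ops)
    show "r \<odot>\<^bsub>F\<^esub> a \<in> ?C" if "r \<in> carrier R" "a \<in> ?C" for r a
      using that by (auto simp: Hom_smult[OF \<alpha>(1)] copower_ops M.smult_r_null F.smult_closed)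
  qed auto
  have N: "submodule ?N R F" by (rule submodule_kernel[OF RF RM f])
  have "z \<in> {\<zero>\<^bsub>F\<^esub>}" if z: "z \<in> ?N \<inter> ?C" for z
  proof (rule ccontr)
    assume nz: "z \<notin> {\<zero>\<^bsub>F\<^esub>}"
    \<comment> \<open>Membership in \<open>?C\<close> gives the inclusion, membership in
      \<open>?N\<close> removes \<open>k\<close>. A smaller support contradicts the choice of
      \<open>y\<close>.\<close>
    have "supp z \<subset> supp y"
      using z k f_eq[of z] by (auto simp: supp_def)
    then have "card (supp z) < card (supp y)" by (rule psubset_card_mono[OF fin[OF y(1)]])
    then show False using min[of z] z nz by simp
  qed
  then have "?N \<inter> ?C = {\<zero>\<^bsub>F\<^esub>}" using submoduleD(2)[OF N] submoduleD(2)[OF C] by blast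
  then have "?N = {\<zero>\<^bsub>F\<^esub>} \<or> ?C = {\<zero>\<^bsub>F\<^esub>}" by (rule uniform[OF N C])
  moreover have "y \<in> ?C" using y by simp
  ultimately have "?N = {\<zero>\<^bsub>F\<^esub>}" using y(2) by blast
  then have "inj_on ?f (carrier F)" using inj_on_Hom_iff[OF RF RM f] by blast
  then show ?thesis using f by (auto simp: embeds_def)
qed

section \<open>Enlarging ideals that miss the identity of an object of rank zero\<close>

lemma embeds_mono:
  assumes "embeds M" "f \<in> Hom R M N" "inj_on f (carrier M)"
  shows "embeds N"
proof -
  obtain \<alpha> where \<alpha>: "\<alpha> \<in> Hom R F M" "inj_on \<alpha> (carrier F)"
    using assms(1) by (auto simp: embeds_def)
  have "inj_on (compose (carrier F) f \<alpha>) (carrier F)"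
    using comp_inj_on[OF \<alpha>(2) inj_on_subset[OF assms(3)]] Hom_closed[OF \<alpha>(1)]
    by (auto simp: compose_def comp_def)
  then show ?thesis
    using Hom_compose[OF F_right_module \<alpha>(1) assms(2)] unfolding embeds_def by blast
qed

text \<open>The last conclusion makes the enlargement strict, since \<open>J\<close> lacks the
  identity of \<open>M\<close>. Properness of the larger ideal is witnessed by a copy inside
  \<open>'u\<close> of the copower of \<open>M\<close> over \<open>Pow W\<close>: it is too large
  for \<open>W\<close>, yet still an object of rank zero.\<close>

lemma enlarge_ideal:
  assumes U: "universe TYPE('u)" and J: "cat_ideal R C\<^sub>F J"
    and M: "M \<in> small_modules R" "\<not> embeds M" and notin: "(\<lambda>x\<in>carrier M. x) \<notin> J M M"
  obtains K where "proper_cat_ideal R C\<^sub>F K" "cat_ideal_le C\<^sub>F J K" "(\<lambda>x\<in>carrier M. x) \<in> K M M"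
proof -
  interpret J: module_cat_ideal R "C\<^sub>F" J using J finite_rank_small by unfold_locales
  have MC: "M \<in> C\<^sub>F" by (rule not_embeds_finite_rank[OF M])
  have RM: "right_module R M" by (rule J.right_module_object[OF MC])
  have nat: "|UNIV :: nat set| <o |UNIV :: 'u set|" using U by (simp add: universe_def small_def)
  have infU: "infinite (UNIV :: 'u set)"
    using ordLess_imp_ordLeq[OF nat] by (simp add: infinite_iff_card_of_nat)
  then obtain e :: "nat \<Rightarrow> 'u" where e: "inj e"
    using infinite_countable_subset by blast
  \<comment> \<open>A copy of the natural numbers is adjoined because \<open>M\<close> may be finite
    while cardinal arithmetic needs an infinite bound; \<open>W\<close> remains small since the
    universe has an infinite small set.\<close>
  define W where "W = carrier M \<union> range e"
  have W: "infinite W" using e finite_imageD by (auto simp: W_def)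
  have "small TYPE('u) W"
    unfolding small_def W_def
  proof (rule card_of_Un_ordLess_infinite[OF infU])
    show "|carrier M| <o |UNIV :: 'u set|" using M(1) by (simp add: small_modules_def small_def)
    show "|range e| <o |UNIV :: 'u set|" by (rule ordLeq_ordLess_trans[OF card_of_image nat])
  qed
  then have "small TYPE('u) (carrier (copower (Pow W) M))"
    by (rule small_copower_Pow[OF U _ W]) (simp add: W_def)
  from isomorphic_small_module[OF right_module_copower[OF RM] this]
  obtain X :: "('r, 'u) module" where X: "X \<in> small_modules R" and iso: "isomorphic R (copower (Pow W) M) X" .
  have RX: "right_module R X" by (rule right_module_small_modules[OF X])
  have "\<not> embeds X"
  proof
    assume eX: "embeds X"
    obtain \<theta> where "\<theta> \<in> Hom R (copower (Pow W) M) X" "bij_betw \<theta> (carrier (copower (Pow W) M)) (carrier X)"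
      using iso by (auto simp: isomorphic_def)
    then obtain \<eta> where "\<eta> \<in> Hom R X (copower (Pow W) M)" "bij_betw \<eta> (carrier X) (carrier (copower (Pow W) M))"
      by (rule Hom_inverse[OF right_module_copower[OF RM] RX])
    then have "embeds (copower (Pow W) M)"
      by (intro embeds_mono[OF eX]) (auto simp: bij_betw_def)
    then show False using embeds_copower[OF RM] M(2) by blast
  qed
  then have XC: "X \<in> C\<^sub>F" by (rule not_embeds_finite_rank[OF X])
  let ?K = "J.add_small_image W"
  have "(\<lambda>x\<in>carrier X. x) \<notin> ?K X X"
    using J.identity_copower_notin_add_small_image[OF W MC XC iso] notin by blast
  then have "\<not> cat_ideal_eq C\<^sub>F ?K (Hom R)"
    using Hom_id[OF RX] XC by (auto simp: cat_ideal_eq_def)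
  then have "proper_cat_ideal R C\<^sub>F ?K"
    using J.cat_ideal_add_small_image[OF W] by (simp add: proper_cat_ideal_def)
  moreover have "cat_ideal_le C\<^sub>F J ?K"
    using J.J_subset_add_small_image[OF W] by (simp add: cat_ideal_le_def)
  moreover have "(\<lambda>x\<in>carrier M. x) \<in> ?K M M"
    by (rule J.identity_in_add_small_image[OF MC card_of_mono1]) (simp add: W_def)
  ultimately show ?thesis by (rule that)
qed

text \<open>
  A morphism \<open>f\<close> lies in the associated ideal iff no composite \<open>f \<alpha>\<close> with \<open>\<alpha>\<close> starting in \<open>F\<close> is injective,
  because an injective composite \<open>f \<alpha>\<close> has a retraction \<open>\<beta>\<close>.
\<close>

lemma associated_ideal_iff:
  assumes I: "maximalideal I (End R F)" and X: "X \<in> small_modules R" and Y: "Y \<in> small_modules R"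
  shows "f \<in> associated_ideal R F I X Y \<longleftrightarrow>
    f \<in> Hom R X Y \<and> (\<forall>\<alpha>\<in>Hom R F X. \<not> inj_on (compose (carrier F) f \<alpha>) (carrier F))"
proof -
  note RF = F_right_module and RY = right_module_small_modules[OF Y]
  have "(\<forall>\<beta>\<in>Hom R Y F. compose (carrier F) \<beta> g \<in> I) \<longleftrightarrow> \<not> inj_on g (carrier F)"
    if g: "g \<in> Hom R F Y" for g
  proof
    assume *: "\<forall>\<beta>\<in>Hom R Y F. compose (carrier F) \<beta> g \<in> I"
    show "\<not> inj_on g (carrier F)"
    proof
      assume "inj_on g (carrier F)"
      from retraction[OF Y g this]
      obtain h where h: "h \<in> Hom R Y F" "\<And>x. x \<in> carrier F \<Longrightarrow> h (g x) = x" by blast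
      then have "inj_on (compose (carrier F) h g) (carrier F)"
        by (simp add: inj_on_def compose_def)
      then show False using * h(1) unfolding maximalideal_End_eq[OF I] by blast
    qed
  next
    assume "\<not> inj_on g (carrier F)"
    then obtain x where x: "x \<in> carrier F" "x \<noteq> \<zero>\<^bsub>F\<^esub>" "g x = \<zero>\<^bsub>Y\<^esub>"
      by (rule not_inj_HomE[OF RY g])
    show "\<forall>\<beta>\<in>Hom R Y F. compose (carrier F) \<beta> g \<in> I"
    proof
      fix \<beta> assume \<beta>: "\<beta> \<in> Hom R Y F"
      have c: "compose (carrier F) \<beta> g \<in> Hom R F F" by (rule Hom_compose[OF RF g \<beta>])
      have "compose (carrier F) \<beta> g x = \<zero>\<^bsub>F\<^esub>"
        using x Hom_zero[OF RY RF \<beta>] by (simp add: compose_eq)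
      then have "\<not> inj_on (compose (carrier F) \<beta> g) (carrier F)"
        using inj_HomD[OF RF c _ x(1)] x(2) by blast
      then show "compose (carrier F) \<beta> g \<in> I" using c unfolding maximalideal_End_eq[OF I] by blast
    qed
  qed
  then show ?thesis
    using Hom_compose[OF RF] unfolding associated_ideal_def by blast
qed

text \<open>Membership means that f \<alpha> kills a nonzero element of F for every \<alpha>.
  Composing on the left keeps that element killed, composing on the right merely changes \<alpha>,
  and for sums uniformity of F provides a common killed element.\<close>

lemma cat_ideal_associated_ideal:
  assumes I: "maximalideal I (End R F)"
  shows "cat_ideal R C\<^sub>F (associated_ideal R F I)"
proof -
  let ?A = "associated_ideal R F I"
  note RF = F_right_module
  note small = subsetD[OF finite_rank_small]
  note RC = right_module_small_modules[OF small]
  note iff = associated_ideal_iff[OF I small small]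
  \<comment> \<open>\<open>vanish\<close> and \<open>memI\<close> are the two directions of this
    elementwise form of membership, which is easier to compose than non-injectivity.\<close>
  have vanish: "\<exists>x\<in>carrier F. x \<noteq> \<zero>\<^bsub>F\<^esub> \<and> f (\<alpha> x) = \<zero>\<^bsub>B\<^esub>"
    if A: "A \<in> C\<^sub>F" and B: "B \<in> C\<^sub>F" and fA: "f \<in> ?A A B" and \<alpha>: "\<alpha> \<in> Hom R F A" for A B f \<alpha>
  proof -
    have f: "f \<in> Hom R A B" "\<not> inj_on (compose (carrier F) f \<alpha>) (carrier F)"
      using fA \<alpha> by (auto simp: iff[OF A B])
    obtain x where "x \<in> carrier F" "x \<noteq> \<zero>\<^bsub>F\<^esub>" "compose (carrier F) f \<alpha> x = \<zero>\<^bsub>B\<^esub>"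
      by (rule not_inj_HomE[OF RC[OF B] Hom_compose[OF RF \<alpha> f(1)] f(2)])
    then show ?thesis by (auto simp: compose_eq)
  qed
  have memI: "f \<in> ?A A B"
    if A: "A \<in> C\<^sub>F" and B: "B \<in> C\<^sub>F" and f: "f \<in> Hom R A B"
      and van: "\<And>\<alpha>. \<alpha> \<in> Hom R F A \<Longrightarrow> \<exists>x\<in>carrier F. x \<noteq> \<zero>\<^bsub>F\<^esub> \<and> f (\<alpha> x) = \<zero>\<^bsub>B\<^esub>" for A B f
    unfolding iff[OF A B]
  proof (intro conjI f ballI notI)
    fix \<alpha> assume \<alpha>: "\<alpha> \<in> Hom R F A" and inj: "inj_on (compose (carrier F) f \<alpha>) (carrier F)"
    obtain x where x: "x \<in> carrier F" "x \<noteq> \<zero>\<^bsub>F\<^esub>" "f (\<alpha> x) = \<zero>\<^bsub>B\<^esub>" using van[OF \<alpha>] by blast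
    then show False
      using inj_HomD[OF RC[OF B] Hom_compose[OF RF \<alpha> f] inj x(1)] by (simp add: compose_eq)
  qed
  have "subgroup (?A A B) (Hom_group R A B)" if A: "A \<in> C\<^sub>F" and B: "B \<in> C\<^sub>F" for A B
  proof -
    note RA = RC[OF A] and RB = RC[OF B]
    interpret B: right_module R B by (rule RB)
    interpret G: comm_group "Hom_group R A B" by (rule Hom_group_comm_group[OF RA RB])
    interpret F: right_module R F by (rule RF)
    obtain z where z: "z \<in> carrier F" "z \<noteq> \<zero>\<^bsub>F\<^esub>" using F_nonzero F.M.zero_closed by blast
    have AH: "f \<in> Hom R A B" if "f \<in> ?A A B" for f using that by (simp add: iff[OF A B])
    show ?thesis
    proof (rule G.subgroupI)
      show "?A A B \<subseteq> carrier (Hom_group R A B)" using AH by (auto simp: Hom_group_def)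
      have "(\<lambda>x\<in>carrier A. \<zero>\<^bsub>B\<^esub>) \<in> ?A A B"
        using z by (intro memI[OF A B Hom_zero_closed[OF RA RB]] bexI[of _ z]) (auto simp: Hom_closed)
      then show "?A A B \<noteq> {}" by blast
    next
      fix f assume f: "f \<in> ?A A B"
      show "inv\<^bsub>Hom_group R A B\<^esub> f \<in> ?A A B"
      proof (rule memI[OF A B inv_Hom_group(1)[OF RA RB AH[OF f]]])
        fix \<alpha> assume \<alpha>: "\<alpha> \<in> Hom R F A"
        obtain x where x: "x \<in> carrier F" "x \<noteq> \<zero>\<^bsub>F\<^esub>" "f (\<alpha> x) = \<zero>\<^bsub>B\<^esub>"
          using vanish[OF A B f \<alpha>] by blast
        then show "\<exists>x\<in>carrier F. x \<noteq> \<zero>\<^bsub>F\<^esub> \<and> (inv\<^bsub>Hom_group R A B\<^esub> f) (\<alpha> x) = \<zero>\<^bsub>B\<^esub>"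
          using inv_Hom_group(2)[OF RA RB AH[OF f] Hom_closed[OF \<alpha> x(1)]] by (intro bexI[of _ x]) simp_all
      qed
    next
      fix f g assume f: "f \<in> ?A A B" and g: "g \<in> ?A A B"
      let ?h = "\<lambda>x\<in>carrier A. f x \<oplus>\<^bsub>B\<^esub> g x"
      have "\<not> inj_on (compose (carrier F) ?h \<alpha>) (carrier F)" if \<alpha>: "\<alpha> \<in> Hom R F A" for \<alpha>
      proof -
        have "\<not> inj_on (\<lambda>x\<in>carrier F. compose (carrier F) f \<alpha> x \<oplus>\<^bsub>B\<^esub> compose (carrier F) g \<alpha> x) (carrier F)"
          using f g \<alpha> by (intro not_inj_add[OF RB] Hom_compose[OF RF \<alpha>]) (auto simp: iff[OF A B])
        moreover have "(\<lambda>x\<in>carrier F. compose (carrier F) f \<alpha> x \<oplus>\<^bsub>B\<^esub> compose (carrier F) g \<alpha> x) = compose (carrier F) ?h \<alpha>"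
          using Hom_closed[OF \<alpha>] by (auto simp: compose_def intro!: restrict_ext)
        ultimately show ?thesis by simp
      qed
      then have "?h \<in> ?A A B" using Hom_add_closed[OF RA RB AH[OF f] AH[OF g]] unfolding iff[OF A B] by blast
      then show "f \<otimes>\<^bsub>Hom_group R A B\<^esub> g \<in> ?A A B" by (simp add: Hom_group_def)
    qed
  qed
  moreover have "compose (carrier X) b (compose (carrier X) f a) \<in> ?A X Y"
    if X: "X \<in> C\<^sub>F" and A: "A \<in> C\<^sub>F" and B: "B \<in> C\<^sub>F" and Y: "Y \<in> C\<^sub>F"
      and a: "a \<in> Hom R X A" and f: "f \<in> ?A A B" and b: "b \<in> Hom R B Y" for X A B Y a f b
  proof -
    have fH: "f \<in> Hom R A B" using f by (simp add: iff[OF A B])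
    have "compose (carrier X) b (compose (carrier X) f a) \<in> Hom R X Y"
      by (intro Hom_compose[OF RC[OF X] _ b] Hom_compose[OF RC[OF X] a fH])
    then show ?thesis
    proof (rule memI[OF X Y])
      fix \<alpha> assume \<alpha>: "\<alpha> \<in> Hom R F X"
      obtain x where x: "x \<in> carrier F" "x \<noteq> \<zero>\<^bsub>F\<^esub>" "f (compose (carrier F) a \<alpha> x) = \<zero>\<^bsub>B\<^esub>"
        using vanish[OF A B f Hom_compose[OF RF \<alpha> a]] by blast
      then show "\<exists>x\<in>carrier F. x \<noteq> \<zero>\<^bsub>F\<^esub> \<and> compose (carrier X) b (compose (carrier X) f a) (\<alpha> x) = \<zero>\<^bsub>Y\<^esub>"
        using Hom_closed[OF \<alpha> x(1)] Hom_zero[OF RC[OF B] RC[OF Y] b]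
        by (intro bexI[of _ x]) (simp_all add: compose_eq)
    qed
  qed
  ultimately show ?thesis unfolding cat_ideal_def by blast
qed

text \<open>If some f in \<open>K\<close> had an injective composite f \<alpha> with \<alpha>
  starting in F, a retraction h would give h f \<alpha> = 1_F, and this belongs to
  \<open>K\<close>.\<close>

lemma ideal_le_associated_ideal:
  assumes I: "maximalideal I (End R F)" and K: "cat_ideal R C\<^sub>F K" and F: "(\<lambda>x\<in>carrier F. x) \<notin> K F F"
  shows "cat_ideal_le C\<^sub>F K (associated_ideal R F I)"
  unfolding cat_ideal_le_def
proof (intro ballI subsetI)
  interpret K: module_cat_ideal R "C\<^sub>F" K using K finite_rank_small by unfold_locales
  fix X Y f assume X: "X \<in> C\<^sub>F" and Y: "Y \<in> C\<^sub>F" and f: "f \<in> K X Y"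
  have Xs: "X \<in> small_modules R" and Ys: "Y \<in> small_modules R" using X Y finite_rank_small by auto
  have fH: "f \<in> Hom R X Y" by (rule K.J_Hom[OF X Y f])
  show "f \<in> associated_ideal R F I X Y"
    unfolding associated_ideal_iff[OF I Xs Ys]
  proof (intro conjI fH ballI notI)
    fix \<alpha> assume \<alpha>: "\<alpha> \<in> Hom R F X" and inj: "inj_on (compose (carrier F) f \<alpha>) (carrier F)"
    from retraction[OF Ys Hom_compose[OF F_right_module \<alpha> fH] inj]
    obtain h where h: "h \<in> Hom R Y F" "\<And>x. x \<in> carrier F \<Longrightarrow> h (compose (carrier F) f \<alpha> x) = x" by blast
    have "(\<lambda>x\<in>carrier F. h (f (\<alpha> x))) = (\<lambda>x\<in>carrier F. x)"
      using h(2) by (intro restrict_ext) (simp add: compose_eq)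
    then show False
      using K.J_comp[OF F_finite_rank X Y F_finite_rank \<alpha> f h(1)] F by simp
  qed
qed

lemma proper_associated_ideal:
  assumes I: "maximalideal I (End R F)"
  shows "proper_cat_ideal R C\<^sub>F (associated_ideal R F I)"
proof -
  have id: "(\<lambda>x\<in>carrier F. x) \<in> Hom R F F" by (rule Hom_id[OF F_right_module])
  have "inj_on (compose (carrier F) (\<lambda>x\<in>carrier F. x) (\<lambda>x\<in>carrier F. x)) (carrier F)"
    by (simp add: inj_on_def compose_def)
  then have "(\<lambda>x\<in>carrier F. x) \<notin> associated_ideal R F I F F"
    using id unfolding associated_ideal_iff[OF I F_small F_small] by blast
  then show ?thesis
    using cat_ideal_associated_ideal[OF I] id F_finite_rank
    unfolding proper_cat_ideal_def cat_ideal_eq_def by blast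
qed

lemma identity_in_associated_ideal:
  assumes "maximalideal I (End R F)" "M \<in> small_modules R" "\<not> embeds M"
  shows "(\<lambda>x\<in>carrier M. x) \<in> associated_ideal R F I M M"
  unfolding associated_ideal_iff[OF assms(1,2,2)]
  using assms(3) Hom_id[OF right_module_small_modules[OF assms(2)]] Hom_compose[OF F_right_module]
  unfolding embeds_def by blast

lemma maximal_associated_ideal:
  assumes I: "maximalideal I (End R F)"
  shows "maximal_cat_ideal R C\<^sub>F (associated_ideal R F I)"
  unfolding maximal_cat_ideal_def
proof (intro conjI allI impI proper_associated_ideal[OF I])
  let ?A = "associated_ideal R F I"
  fix K assume *: "proper_cat_ideal R C\<^sub>F K \<and> cat_ideal_le C\<^sub>F ?A K"
  then have K: "cat_ideal R C\<^sub>F K" and proper: "\<not> cat_ideal_eq C\<^sub>F K (Hom R)" and le: "cat_ideal_le C\<^sub>F ?A K"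
    by (auto simp: proper_cat_ideal_def)
  interpret K: module_cat_ideal R "C\<^sub>F" K using K finite_rank_small by unfold_locales
  have "(\<lambda>x\<in>carrier F. x) \<notin> K F F"
  proof
    assume FK: "(\<lambda>x\<in>carrier F. x) \<in> K F F"
    have "(\<lambda>x\<in>carrier X. x) \<in> K X X" if X: "X \<in> C\<^sub>F" for X
    proof -
      obtain M where M: "M \<in> small_modules R" "\<not> embeds M"
        and imp: "(\<lambda>x\<in>carrier M. x) \<in> K M M \<longrightarrow> (\<lambda>x\<in>carrier X. x) \<in> K X X"
        by (rule reduce_to_rank_zero[OF K FK X])
      show ?thesis
        using identity_in_associated_ideal[OF I M] not_embeds_finite_rank[OF M] le
        by (intro imp[rule_format]) (auto simp: cat_ideal_le_def)
    qed
    then show False using K.eq_Hom_if_identities proper by blast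
  qed
  then have "cat_ideal_le C\<^sub>F K ?A" by (rule ideal_le_associated_ideal[OF I K])
  then show "cat_ideal_eq C\<^sub>F ?A K"
    using le unfolding cat_ideal_le_def cat_ideal_eq_def by blast
qed

lemma maximal_ideal_eq_associated_ideal:
  assumes U: "universe TYPE('u)" and I: "maximalideal I (End R F)" and max: "maximal_cat_ideal R C\<^sub>F J"
  shows "cat_ideal_eq C\<^sub>F J (associated_ideal R F I)"
proof -
  have J: "cat_ideal R C\<^sub>F J" and proper: "\<not> cat_ideal_eq C\<^sub>F J (Hom R)"
    and maxD: "\<And>K. \<lbrakk>proper_cat_ideal R C\<^sub>F K; cat_ideal_le C\<^sub>F J K\<rbrakk> \<Longrightarrow> cat_ideal_eq C\<^sub>F J K"
    using max by (auto simp: maximal_cat_ideal_def proper_cat_ideal_def)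
  interpret J: module_cat_ideal R "C\<^sub>F" J using J finite_rank_small by unfold_locales
  have "(\<lambda>x\<in>carrier F. x) \<notin> J F F"
  proof
    assume FJ: "(\<lambda>x\<in>carrier F. x) \<in> J F F"
    \<comment> \<open>Properness of \<open>J\<close> provides an object whose identity is missing;
      modulo \<open>J\<close> it is its summand of rank zero, so the identity of that summand is
      missing too.\<close>
    obtain X where X: "X \<in> C\<^sub>F" "(\<lambda>x\<in>carrier X. x) \<notin> J X X"
      using J.eq_Hom_if_identities proper by blast
    obtain M where M: "M \<in> small_modules R" "\<not> embeds M"
      and imp: "(\<lambda>x\<in>carrier M. x) \<in> J M M \<longrightarrow> (\<lambda>x\<in>carrier X. x) \<in> J X X"
      by (rule reduce_to_rank_zero[OF J FJ X(1)])
    have notin: "(\<lambda>x\<in>carrier M. x) \<notin> J M M" using imp X(2) by blast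
    obtain K where K: "proper_cat_ideal R C\<^sub>F K" "cat_ideal_le C\<^sub>F J K" "(\<lambda>x\<in>carrier M. x) \<in> K M M"
      by (rule enlarge_ideal[OF U J M notin])
    then show False
      using maxD[OF K(1,2)] notin not_embeds_finite_rank[OF M] unfolding cat_ideal_eq_def by blast
  qed
  \<comment> \<open>Now \<open>J\<close> lies below the associated ideal, which is proper, so
    maximality of \<open>J\<close> itself forces equality.\<close>
  then show ?thesis
    by (intro maxD proper_associated_ideal[OF I] ideal_le_associated_ideal[OF I J])
qed

end


theorem proposition4p6:
  fixes R :: "('r, 'x) ring_scheme"
    and F :: "('r, 'u) module"
    and I :: "('u \<Rightarrow> 'u) set"
  assumes "universe TYPE('u)"
    and "small TYPE('u) (carrier R)"
    and "right_noetherian R"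
    and "F \<in> small_modules R"
    and "indecomposable R F"
    and "injective R F"
    and "maximalideal I (End R F)"
  shows "maximal_cat_ideal R (finite_rank_modules R F) (associated_ideal R F I) \<and>
    (\<forall>J. maximal_cat_ideal R (finite_rank_modules R F) J \<longrightarrow>
       cat_ideal_eq (finite_rank_modules R F) J (associated_ideal R F I))"
proof -
  interpret indecomposable_injective R F using assms(4-6) by unfold_locales
  show ?thesis
    using maximal_associated_ideal[OF assms(7)] maximal_ideal_eq_associated_ideal[OF assms(1,7)] by blast
qed

end
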